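(* For every $p\in(0,1/2)$, the $P$-harmonic functions on the Martin boundary, regarded as functions on the Sierpiński gasket $\mathcal K$, coincide with the canonical harmonic functions on $\mathcal K$; hence the space of $P$-harmonic functions on $\mathcal K$ is three-dimensional.
   Context: Let $\Sigma=\{1,2,3\}$, $\Sigma^0=\{\vartheta\}$ with $\vartheta$ the empty word, $\Sigma^n=\{1,2,3\}^n$, $\Sigma^*=\bigcup_{n\ge 0}\Sigma^n$ and $\Sigma^\infty=\{1,2,3\}^{\mathbb N}$. For $a\in\Sigma$, $a^n$ is the word consisting of $n$ letters $a$ and $a^\infty$ the infinite word with all letters $a$; for $\mathbf x\in\Sigma^\infty$, $\mathbf x|_n$ is the prefix of length $n$. For $n\ge1$ put $V^n=\{1^n,2^n,3^n\}$ and $\tilde\Sigma^n=\Sigma^n\setminus V^n$. Fix $p\in(0,1/2)$ and $q=1-2p$. Every $u\in\tilde\Sigma^n$ is uniquely of the form $u=\omega i j^{n-k}$ with $1\le k\le n-1$, $\omega\in\Sigma^{k-1}$ and $i\ne j$ in $\Sigma$; let $l$ be the third letter. The Markov chain $(X_m)_{m\ge0}$ with origin $\vartheta$ and state space $\Sigma^*$ has transition probabilities: $P(\vartheta,i)=1/3$ for $i\in\Sigma$; for $u=\omega i j^{n-k}\in\tilde\Sigma^n$ with $1\le k\le n-1$, $\omega\in\Sigma^{k-1}$, $i\ne j$ in $\Sigma$ and $l$ the element of $\Sigma\setminus\{i,j\}$, $P(u,\omega j i^{n-k})=p$, $P(u,\omega i j^{n-k-1}i)=p$, $P(u,\omega i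 j^{n-k-1}l)=q$; for $u\in V^n$ ($n\ge1$), $P(u,ui)=1/3$ for $i\in\Sigma$; all other transition probabilities are $0$. For $x,y\in\Sigma^*$ let $\rho_{x,y}=\mathbb P(\exists k\ge 0: X_k=y\mid X_0=x)$ and let $K(x,y)=\rho_{x,y}/\rho_{\vartheta,y}$ be the Martin kernel; for $\mathbf y\in\Sigma^\infty$ put $K(x,\mathbf y)=\lim_{n\to\infty}K(x,\mathbf y|_n)$ (this limit exists). A function $u:\Sigma^*\to\mathbb R$ is $P$-harmonic if $\sum_{y\in\Sigma^*}P(x,y)u(y)=u(x)$ for all $x\in\Sigma^*$. For $i\in\Sigma$ put $h_i(x)=K(x,i^\infty)$, $x\in\Sigma^*$; each non-negative $P$-harmonic function is a linear combination of $h_1,h_2,h_3$. Each $h_i$ extends by $h_i(\mathbf x)=\lim_{n\to\infty}h_i(\mathbf x|_n)$, $\mathbf x\in\Sigma^\infty$. Let $q_1=(1/2,\sqrt3/2)$, $q_2=(0,0)$, $q_3=(1,0)$, $S_i(x)=\frac12(x+q_i)$ on $\mathbb R^2$, $S_\omega=S_{\omega_1}\circ\cdots\circ S_{\omega_n}$ for $\omega=\omega_1\cdots\omega_n\in\Sigma^n$ ($S_\vartheta=\mathrm{id}$), and let $\mathcal K$ be the Sierpiński gasket, the unique non-empty compact set with $\mathcal K=\bigcup_{i=1}^3S_i(\mathcal K)$. The standard projection $\pi:\Sigma^\infty\to\mathcal K$ is $\pi(i_1i_2\ldots)=\lim_n S_{i_1}\circ\cdots\circ S_{i_n}(x_0)$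 for any $x_0\in\mathbb R^2$. The map $\pi$ induces an identification of $\Sigma^\infty/{\sim_\pi}$ ($\mathbf x\sim_\pi\mathbf y$ iff $\pi(\mathbf x)=\pi(\mathbf y)$) with $\mathcal K$, and the Martin boundary (the boundary of the completion of $\Sigma^*$ with respect to the Martin metric) is identified with $\Sigma^\infty/{\sim_\pi}$, $\mathbf x$ corresponding to the limit of $(\mathbf x|_n)_n$. The functions $h_i$ are well defined and continuous on it. The $P$-harmonic functions on the Martin boundary (equivalently on $\mathcal K$) are the real linear combinations of the extended functions $h_1,h_2,h_3$, viewed as functions on $\mathcal K$ via $\pi$. Canonical harmonic functions on $\mathcal K$: let $G_n$ ($n\ge0$) be the graph with vertices $S_\omega(q_i)$, $\omega\in\Sigma^n$, $i\in\Sigma$, and with edges joining $S_\omega(q_i)$ and $S_\omega(q_j)$ for $\omega\in\Sigma^n$ and $i\neq j$. A continuous function $h:\mathcal K\to\mathbb R$ is a canonical harmonic function if for every $n\ge1$ and every vertex $x$ of $G_n$ with $x\notin\{q_1,q_2,q_3\}$, $h(x)$ is the average of the values of $h$ at the four neighbours of $x$ in $G_n$. *)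

theory Defs
  imports "HOL-Probability.Probability" "HOL-Library.Function_Algebras"
begin

datatype letter = L1 | L2 | L3

lemma UNIV_letter: "UNIV = {L1, L2, L3}"
  by (auto intro: letter.exhaust)

instance letter :: finite
  by standard (simp add: UNIV_letter)

type_synonym word = "letter list"
type_synonym inf_word = "nat \<Rightarrow> letter"

definition trunc :: "inf_word \<Rightarrow> nat \<Rightarrow> word"
  where "trunc x n = map x [0..<n]"

definition const_words :: "nat \<Rightarrow> word set"
  where "const_words n = {replicate n i | i. True}"

text \<open>A word \<open>u = \<omega> i j\<^bsup>n - k\<^esup>\<close> with \<open>1 \<le> k \<le> n - 1\<close> and \<open>i \<noteq> j\<close> is written as
  \<open>\<omega> @ i # replicate (Suc m) j\<close>, where \<open>Suc m = n - k\<close>.\<close>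

definition trans_prob :: "real \<Rightarrow> word \<Rightarrow> word \<Rightarrow> real" where
  "trans_prob p u v =
    (if u = [] \<and> (\<exists>i. v = [i]) then 1 / 3
     else if (\<exists>n\<ge>1. u \<in> const_words n) \<and> (\<exists>i. v = u @ [i]) then 1 / 3
     else if \<exists>\<omega> i j m. i \<noteq> j \<and> u = \<omega> @ i # replicate (Suc m) j \<and>
               (v = \<omega> @ j # replicate (Suc m) i \<or> v = \<omega> @ i # replicate m j @ [i]) then p
     else if \<exists>\<omega> i j l m. i \<noteq> j \<and> l \<notin> {i, j} \<and> u = \<omega> @ i # replicate (Suc m) j \<and>
               v = \<omega> @ i # replicate m j @ [l] then 1 - 2 * p
     else 0)"

definition step :: "real \<Rightarrow> word \<Rightarrow> word pmf"
  where "step p u = embed_pmf (trans_prob p u)"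

lemma decomp_unique:
  assumes "\<omega> @ i # replicate (Suc m) j = \<omega>' @ i' # replicate (Suc m') j'"
    and "i \<noteq> j" "i' \<noteq> j'"
  shows "\<omega> = \<omega>' \<and> i = i' \<and> j = j' \<and> m = m'"
proof -
  have r: "replicate (Suc m) j @ i # rev \<omega> = replicate (Suc m') j' @ i' # rev \<omega>'"
    using arg_cong[OF assms(1), of rev] by (simp del: replicate_Suc)
  hence jj: "j = j'" by simp
  have *: "takeWhile (\<lambda>x. x = j) (replicate k j @ x # xs) = replicate k j"
    if "x \<noteq> j" for k x xs using that by (induction k) auto
  have "replicate (Suc m) j = replicate (Suc m') j"
    using arg_cong[OF r, of "takeWhile (\<lambda>x. x = j)"] *[of i "Suc m"] *[of i' "Suc m'"] assms jj
    by simp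
  hence "m = m'" by (metis length_replicate nat.inject)
  with r jj show ?thesis by simp
qed

lemma decomp_not_const:
  assumes "i \<noteq> j" shows "\<omega> @ i # replicate (Suc m) j \<notin> const_words n"
proof
  assume "\<omega> @ i # replicate (Suc m) j \<in> const_words n"
  then obtain a where "\<omega> @ i # replicate (Suc m) j = replicate n a"
    by (auto simp: const_words_def)
  hence "x = a" if "x \<in> set (\<omega> @ i # replicate (Suc m) j)" for x
    using that by (metis in_set_replicate)
  hence "i = a" "j = a" by auto
  thus False using assms by simp
qed

lemma decomp_exists:
  assumes "\<forall>n. u \<notin> const_words n"
  obtains \<omega> i j m where "i \<noteq> j" "u = \<omega> @ i # replicate (Suc m) j"
proof -
  have "(\<exists>n. u \<in> const_words n) \<or> (\<exists>\<omega> i j m. i \<noteq> j \<and> u = \<omega> @ i # replicate (Suc m) j)"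
  proof (induction u rule: rev_induct)
    case Nil
    have "[] \<in> const_words 0" by (auto simp: const_words_def)
    thus ?case by blast
  next
    case (snoc a u)
    from snoc.IH show ?case
    proof (elim disjE exE conjE)
      fix n assume "u \<in> const_words n"
      then obtain b where u: "u = replicate n b" by (auto simp: const_words_def)
      show ?case
      proof (cases "a = b \<or> n = 0")
        case True
        hence "u @ [a] = replicate (Suc n) a" using u by (auto simp: replicate_append_same)
        hence "u @ [a] \<in> const_words (Suc n)" unfolding const_words_def by blast
        thus ?thesis by blast
      next
        case False
        then obtain k where "n = Suc k" by (cases n) auto
        hence "u @ [a] = replicate k b @ b # replicate (Suc 0) a"
          using u by (simp add: replicate_app_Cons_same)
        moreover have "b \<noteq> a" using False by blast
        ultimately show ?thesis by (intro disjI2 exI conjI)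
      qed
    next
      fix \<omega> i j m assume ij: "i \<noteq> j" and u: "u = \<omega> @ i # replicate (Suc m) j"
      show ?case
      proof (cases "a = j")
        case True
        hence "u @ [a] = \<omega> @ i # replicate (Suc (Suc m)) j"
          using u by (simp add: replicate_append_same)
        thus ?thesis using ij by (intro disjI2 exI conjI)
      next
        case False
        have "u @ [a] = (\<omega> @ i # replicate m j) @ j # replicate (Suc 0) a"
          using u by (simp add: replicate_app_Cons_same)
        moreover have "j \<noteq> a" using False by blast
        ultimately show ?thesis by (intro disjI2 exI conjI)
      qed
    qed
  qed
  thus ?thesis using assms that by blast
qed

lemma trans_prob_const:
  assumes "u \<in> const_words n"
  shows "trans_prob p u v = (if v \<in> {u @ [L1], u @ [L2], u @ [L3]} then 1 / 3 else 0)"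
proof -
  have ex: "(\<exists>i. v = u @ [i]) \<longleftrightarrow> v \<in> {u @ [L1], u @ [L2], u @ [L3]}"
  proof
    assume "\<exists>i. v = u @ [i]"
    then obtain i where "v = u @ [i]" ..
    thus "v \<in> {u @ [L1], u @ [L2], u @ [L3]}" by (cases i) simp_all
  qed blast
  have "u = [] \<or> (\<exists>n\<ge>1. u \<in> const_words n)"
    using assms by (cases n) (auto simp: const_words_def)
  hence c1: "u = [] \<and> (\<exists>i. v = [i]) \<or> (\<exists>n\<ge>1. u \<in> const_words n) \<and> (\<exists>i. v = u @ [i]) \<longleftrightarrow>
      (\<exists>i. v = u @ [i])"
    by (metis append_Nil)
  have N: "(i \<noteq> j \<and> u = \<omega> @ i # replicate (Suc m) j) = False" for \<omega> i j m
    using decomp_not_const assms by blast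
  have c2: "(\<exists>\<omega> i j m. i \<noteq> j \<and> u = \<omega> @ i # replicate (Suc m) j \<and>
      (v = \<omega> @ j # replicate (Suc m) i \<or> v = \<omega> @ i # replicate m j @ [i])) = False"
    unfolding conj_assoc[symmetric] N by simp
  have c3: "(\<exists>\<omega> i j l m. i \<noteq> j \<and> l \<notin> {i, j} \<and> u = \<omega> @ i # replicate (Suc m) j \<and>
      v = \<omega> @ i # replicate m j @ [l]) = False"
    using N by (metis (no_types))
  have if_disj: "(if A then t else if B then t else s) = (if A \<or> B then t else s)"
    for A B and s t :: real
    by simp
  show ?thesis
    unfolding trans_prob_def c2 c3 if_disj c1 unfolding ex by (simp only: if_False)
qed

lemma trans_prob_decomp:
  assumes "i \<noteq> j" "l \<notin> {i, j}" "u = \<omega> @ i # replicate (Suc m) j"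
  shows "trans_prob p u v =
    (if v = \<omega> @ j # replicate (Suc m) i then p
     else if v = \<omega> @ i # replicate m j @ [i] then p
     else if v = \<omega> @ i # replicate m j @ [l] then 1 - 2 * p else 0)"
proof -
  have u: "u \<noteq> []" "u \<notin> const_words n" for n
    using assms decomp_not_const by auto
  have l: "l' = l" if "l' \<notin> {i, j}" for l'
    using that assms(1,2) by (cases i; cases j; cases l; cases l') auto
  have D: "(i' \<noteq> j' \<and> u = \<omega>' @ i' # replicate (Suc m') j') \<longleftrightarrow>
      (\<omega>' = \<omega> \<and> i' = i \<and> j' = j \<and> m' = m)" for \<omega>' i' j' m'
    using decomp_unique[of \<omega> i m j \<omega>' i' m' j'] assms(1,3) by (metis (no_types))
  have c1: "(\<exists>\<omega>' i' j' m'. i' \<noteq> j' \<and> u = \<omega>' @ i' # replicate (Suc m') j' \<and>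
      (v = \<omega>' @ j' # replicate (Suc m') i' \<or> v = \<omega>' @ i' # replicate m' j' @ [i'])) \<longleftrightarrow>
      v = \<omega> @ j # replicate (Suc m) i \<or> v = \<omega> @ i # replicate m j @ [i]"
    unfolding conj_assoc[symmetric] D unfolding conj_assoc by (simp only: ex_simps simp_thms)
  have "(\<exists>\<omega>' i' j' l' m'. i' \<noteq> j' \<and> l' \<notin> {i', j'} \<and> u = \<omega>' @ i' # replicate (Suc m') j' \<and>
        v = \<omega>' @ i' # replicate m' j' @ [l']) \<longleftrightarrow>
      (\<exists>\<omega>' i' j' l' m'. (i' \<noteq> j' \<and> u = \<omega>' @ i' # replicate (Suc m') j') \<and> l' \<notin> {i', j'} \<and>
        v = \<omega>' @ i' # replicate m' j' @ [l'])"
    by (simp only: conj_ac)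
  also have "\<dots> \<longleftrightarrow> (\<exists>l'. l' \<notin> {i, j} \<and> v = \<omega> @ i # replicate m j @ [l'])"
    unfolding D by blast
  also have "\<dots> \<longleftrightarrow> v = \<omega> @ i # replicate m j @ [l]"
    using l assms(2) by blast
  finally have c2: "(\<exists>\<omega>' i' j' l' m'. i' \<noteq> j' \<and> l' \<notin> {i', j'} \<and>
      u = \<omega>' @ i' # replicate (Suc m') j' \<and> v = \<omega>' @ i' # replicate m' j' @ [l']) \<longleftrightarrow>
      v = \<omega> @ i # replicate m j @ [l]" .
  show ?thesis
    unfolding trans_prob_def c1 c2 using u by simp
qed

lemma pmf_step:
  assumes "0 < p" "p < 1 / 2"
  shows "pmf (step p u) v = trans_prob p u v"
proof -
  have nonneg: "0 \<le> trans_prob p u v" for v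
    using assms by (auto simp: trans_prob_def)
  have "\<exists>A. finite A \<and> (\<forall>v. v \<notin> A \<longrightarrow> trans_prob p u v = 0) \<and> (\<Sum>v\<in>A. trans_prob p u v) = 1"
  proof (cases "\<exists>n. u \<in> const_words n")
    case True
    then obtain n where "u \<in> const_words n" ..
    note eq = trans_prob_const[OF this]
    show ?thesis
      by (rule exI[of _ "{u @ [L1], u @ [L2], u @ [L3]}"]) (simp add: eq)
  next
    case False
    hence "\<forall>n. u \<notin> const_words n" by simp
    then obtain \<omega> i j m where ij: "i \<noteq> j" and u: "u = \<omega> @ i # replicate (Suc m) j"
      by (rule decomp_exists)
    have "\<exists>l. l \<notin> {i, j}"
    proof (rule ccontr)
      assume "\<nexists>l. l \<notin> {i, j}"
      hence "UNIV = {i, j}" by blast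
      thus False unfolding UNIV_letter by auto
    qed
    then obtain l where l: "l \<notin> {i, j}" ..
    define a b c where "a = \<omega> @ j # replicate (Suc m) i"
      and "b = \<omega> @ i # replicate m j @ [i]" and "c = \<omega> @ i # replicate m j @ [l]"
    have "a \<noteq> b" "a \<noteq> c" "b \<noteq> c"
      using ij l by (auto simp: a_def b_def c_def)
    moreover have "trans_prob p u v = (if v = a then p else if v = b then p
        else if v = c then 1 - 2 * p else 0)" for v
      unfolding a_def b_def c_def by (rule trans_prob_decomp[OF ij l u])
    ultimately show ?thesis
      by (intro exI[of _ "{a, b, c}"]) simp
  qed
  then obtain A where A: "finite A" "\<And>v. v \<notin> A \<Longrightarrow> trans_prob p u v = 0"
      "(\<Sum>v\<in>A. trans_prob p u v) = 1"
    by blast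
  have "(\<integral>\<^sup>+v. ennreal (trans_prob p u v) \<partial>count_space UNIV) = (\<Sum>v\<in>A. ennreal (trans_prob p u v))"
    using A by (intro nn_integral_count_space') auto
  also have "\<dots> = 1" using A nonneg by (simp add: sum_ennreal)
  finally show ?thesis unfolding step_def using nonneg by (intro pmf_embed_pmf) auto
qed

definition chain_kernel :: "real \<Rightarrow> word \<Rightarrow> nat \<Rightarrow> (nat \<Rightarrow> word) \<Rightarrow> word measure" where
  "chain_kernel p x n X =
    (case n of 0 \<Rightarrow> measure_pmf (return_pmf x) | Suc m \<Rightarrow> measure_pmf (step p (X m)))"

interpretation chain: Ionescu_Tulcea "chain_kernel p x" "\<lambda>_. count_space UNIV" for p x
proof (rule Ionescu_Tulcea.intro)
  fix n
  show "chain_kernel p x n \<in>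
      measurable (PiM {0..<n} (\<lambda>_. count_space UNIV)) (subprob_algebra (count_space UNIV))"
  proof (cases n)
    case (Suc m)
    have "(\<lambda>X. X m) \<in> measurable (PiM {0..<n} (\<lambda>_. count_space UNIV)) (count_space UNIV)"
      using Suc by (intro measurable_component_singleton) auto
    moreover have "(\<lambda>u. measure_pmf (step p u)) \<in>
        measurable (count_space UNIV) (subprob_algebra (count_space UNIV))"
      using measure_pmf_in_subprob_algebra by auto
    ultimately have "(\<lambda>X. measure_pmf (step p (X m))) \<in>
        measurable (PiM {0..<n} (\<lambda>_. count_space UNIV)) (subprob_algebra (count_space UNIV))"
      by (rule measurable_compose)
    thus ?thesis by (simp add: chain_kernel_def[abs_def] Suc)
  qed (simp add: chain_kernel_def[abs_def] measure_pmf_in_subprob_algebra)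
next
  fix n X
  show "prob_space (chain_kernel p x n X)"
    by (simp add: chain_kernel_def measure_pmf.prob_space_axioms split: nat.split)
qed

text \<open>Law of the trajectory \<open>(X\<^sub>m)\<close> with \<open>X\<^sub>0 = x\<close>, obtained from the Ionescu-Tulcea theorem.\<close>

definition path_measure :: "real \<Rightarrow> word \<Rightarrow> (nat \<Rightarrow> word) measure"
  where "path_measure p x = chain.PF.lim p x"

definition hit_prob :: "real \<Rightarrow> word \<Rightarrow> word \<Rightarrow> real" where
  "hit_prob p x y = measure (path_measure p x) {X \<in> space (path_measure p x). \<exists>k. X k = y}"

definition martin_kernel :: "real \<Rightarrow> word \<Rightarrow> word \<Rightarrow> real"
  where "martin_kernel p x y = hit_prob p x y / hit_prob p [] y"

definition martin_kernel_bdry :: "real \<Rightarrow> word \<Rightarrow> inf_word \<Rightarrow> real"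
  where "martin_kernel_bdry p x y = lim (\<lambda>n. martin_kernel p x (trunc y n))"

definition basic_harmonic :: "real \<Rightarrow> letter \<Rightarrow> word \<Rightarrow> real"
  where "basic_harmonic p i x = martin_kernel_bdry p x (\<lambda>_. i)"

definition basic_harmonic_bdry :: "real \<Rightarrow> letter \<Rightarrow> inf_word \<Rightarrow> real"
  where "basic_harmonic_bdry p i x = lim (\<lambda>n. basic_harmonic p i (trunc x n))"

primrec corner :: "letter \<Rightarrow> real ^ 2" where
  "corner L1 = vector [1 / 2, sqrt 3 / 2]"
| "corner L2 = vector [0, 0]"
| "corner L3 = vector [1, 0]"

definition contr :: "letter \<Rightarrow> real ^ 2 \<Rightarrow> real ^ 2"
  where "contr i x = (1 / 2) *\<^sub>R (x + corner i)"

text \<open>\<open>contr_word [i\<^sub>1, \<dots>, i\<^sub>n] = contr i\<^sub>1 \<circ> \<dots> \<circ> contr i\<^sub>n\<close>\<close>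

definition contr_word :: "word \<Rightarrow> real ^ 2 \<Rightarrow> real ^ 2"
  where "contr_word \<omega> = foldr contr \<omega>"

definition gasket :: "(real ^ 2) set"
  where "gasket = (THE A. compact A \<and> A \<noteq> {} \<and> A = (\<Union>i. contr i ` A))"

text \<open>The limit does not depend on the base point, taken to be the origin here.\<close>

definition proj :: "inf_word \<Rightarrow> real ^ 2"
  where "proj x = lim (\<lambda>n. contr_word (trunc x n) 0)"

text \<open>A function on the gasket is represented by its extension by zero to \<open>real ^ 2\<close>; in this way
  functions on the gasket form a subspace of the vector space of all functions on \<open>real ^ 2\<close>
  with pointwise operations.\<close>

definition gasket_funs :: "(real ^ 2 \<Rightarrow> real) set"
  where "gasket_funs = {u. \<forall>x. x \<notin> gasket \<longrightarrow> u x = 0}"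

interpretation fun_vs: vector_space "\<lambda>(c::real) (u::real ^ 2 \<Rightarrow> real) x. c * u x"
  by unfold_locales (auto simp: algebra_simps)

text \<open>The Martin boundary is the quotient of \<open>inf_word\<close> by equality of \<open>proj\<close>; a function on it
  corresponds to the function \<open>u\<close> on the gasket whose pullback along \<open>proj\<close> is the given function
  on infinite words.  Each \<open>basic_harmonic_bdry p i\<close> is a function of infinite words; that a linear
  combination descends to the quotient is expressed by the existence of \<open>u\<close>.\<close>

definition P_harmonic_gasket :: "real \<Rightarrow> (real ^ 2 \<Rightarrow> real) set" where
  "P_harmonic_gasket p =
    {u \<in> gasket_funs. \<exists>c. \<forall>x. u (proj x) = (\<Sum>i\<in>UNIV. c i * basic_harmonic_bdry p i x)}"

definition vertices :: "nat \<Rightarrow> (real ^ 2) set"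
  where "vertices n = {contr_word \<omega> (corner i) | \<omega> i. length \<omega> = n}"

definition neighbours :: "nat \<Rightarrow> real ^ 2 \<Rightarrow> (real ^ 2) set" where
  "neighbours n x = {y. \<exists>\<omega> i j. length \<omega> = n \<and> i \<noteq> j \<and>
     x = contr_word \<omega> (corner i) \<and> y = contr_word \<omega> (corner j)}"

definition canonical_harmonic :: "(real ^ 2 \<Rightarrow> real) set" where
  "canonical_harmonic =
    {h \<in> gasket_funs. continuous_on gasket h \<and>
       (\<forall>n\<ge>1. \<forall>x\<in>vertices n - range corner. h x = (\<Sum>y\<in>neighbours n x. h y) / 4)}"

end

theory Submission
  imports Defs
begin

text \<open>  The parameter \<open>p\<close> disappears from the theorem because the equations that \<open>P\<close>-harmonicity
  imposes on the words of one length \<open>n\<close> can be solved in closed form.  Prescribe values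
  \<open>a\<^sub>1, a\<^sub>2, a\<^sub>3\<close> at the three constant words of length \<open>n\<close>.  The words that begin with a letter
  \<open>j\<close> carry the same transitions as the words of length \<open>n - 1\<close>, so the solution on them is the
  solution for the corner values of that block: \<open>a\<^sub>j\<close>, and at the corners towards \<open>i\<close> and \<open>l\<close>
  \<open>a\<^sub>j + \<alpha> (a\<^sub>i - a\<^sub>j) + \<beta> (a\<^sub>l - a\<^sub>j)\<close> and \<open>a\<^sub>j + \<alpha> (a\<^sub>l - a\<^sub>j) + \<beta> (a\<^sub>i - a\<^sub>j)\<close>.  The
  coefficients depend on the length of the words and on \<open>p\<close>.  They come from a small electrical
  network: seen from one of its corners, a block acts like two edges of conductances \<open>P\<close> and \<open>Q\<close>
  towards its other corners, while the edge to the neighbouring block has conductance \<open>p\<close>.  As the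
  blocks grow, \<open>P\<close> and \<open>Q\<close> tend to \<open>0\<close>, and their ratio \<open>\<rho>\<close> obeys
  \<open>\<rho>' - 1 = (\<rho> - 1) \<rho> / (2 \<rho> + 1)\<close>, hence tends to \<open>1\<close>.  Therefore \<open>\<alpha> \<longlonglongrightarrow> 2/5\<close> and
  \<open>\<beta> \<longlonglongrightarrow> 1/5\<close> whatever \<open>p\<close> was, and these limits are the rule by which canonical harmonic
  functions extend from the corners of a triangle to the midpoints of its sides.

  On the side of the chain, the probability of ever reaching the constant word \<open>c\<^sup>n\<close> is the bounded
  function that is \<open>1\<close> there, vanishes on longer words and satisfies the mean value equation
  elsewhere (\<open>hit_prob_eqI\<close>), because the chain leaves every level.  The closed form is such a
  function (\<open>exit_val_harmonic\<close>); passing from one level to the previous one only pulls its corner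
  values towards their mean, by factors whose product from level \<open>m\<close> on tends to \<open>1\<close> with \<open>m\<close>.
  Letting the length grow along an infinite word, the extended \<open>h\<^sub>c\<close> is three times the function
  obtained by iterating the \<open>2/5\<close>-\<open>1/5\<close> rule from the indicator of the corner \<open>c\<close>
  (\<open>basic_harmonic_bdry_eq\<close>).

  On the side of the gasket, the mean value property at the three midpoints of a triangle forces
  the same rule (\<open>canonical_harmonic_extend\<close>).  Conversely, iterating the rule from arbitrary
  corner values gives a function of infinite words that respects the identifications made by
  \<open>proj\<close>, is continuous and has the mean value property at every vertex
  (\<open>canonical_harmonicI\<close>).  So both spaces of functions are the range of the linear map
  \<open>gasket_extension\<close> on triples of corner values; it is injective, since a function in its range
  takes the prescribed values at the corners, and the dimension is three.\<close>

section \<open>Hitting probabilities from the mean value equation\<close>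

lemma (in Ionescu_Tulcea) nn_integral_lim_restrict:
  assumes h: "h \<in> borel_measurable (PiM {0..<n} M)"
  shows "(\<integral>\<^sup>+X. h (restrict X {0..<n}) \<partial>PF.lim) = (\<integral>\<^sup>+X. h X \<partial>C 0 n (\<lambda>_. undefined))"
proof -
  have u: "up_to {0..<n} = n"
    by (rule antisym, simp add: up_to_iff) (use up_to[of "{0..<n}"] in \<open>cases n; force\<close>)
  have m: "(\<lambda>X. restrict X {0..<n}) \<in> measurable PF.lim (PiM {0..<n} M)"
    by (simp add: measurable_cong_sets[OF PF.sets_lim] measurable_restrict_subset)
  have m': "(\<lambda>X. restrict X {0..<n}) \<in> measurable (C 0 n (\<lambda>_. undefined)) (PiM {0..<n} M)"
    using measurable_restrict_subset[of "{0..<n}" "{0..<n}" M]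
    by (subst measurable_cong_sets[OF sets_C refl]) simp_all
  have "(\<integral>\<^sup>+X. h (restrict X {0..<n}) \<partial>PF.lim) = (\<integral>\<^sup>+X. h X \<partial>CI {0..<n})"
    by (subst distr_lim[symmetric]) (simp_all add: nn_integral_distr[OF m] h)
  also have "\<dots> = (\<integral>\<^sup>+X. h (restrict X {0..<n}) \<partial>C 0 n (\<lambda>_. undefined))"
    unfolding CI_def u by (simp add: nn_integral_distr[OF m'] h)
  also have "\<dots> = (\<integral>\<^sup>+X. h X \<partial>C 0 n (\<lambda>_. undefined))"
    by (intro nn_integral_cong arg_cong[where f=h]) (simp add: space_C space_PiM PiE_def extensional_restrict)
  finally show ?thesis .
qed

text \<open>The last coordinate of a trajectory of length \<open>Suc n\<close> can be integrated out first.  This is the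
  form in which the Markov property is available for a measure built by successive kernels.\<close>

lemma (in Ionescu_Tulcea) nn_integral_lim_Suc:
  assumes h: "h \<in> borel_measurable (PiM {0..<Suc n} M)"
  shows "(\<integral>\<^sup>+X. h (restrict X {0..<Suc n}) \<partial>PF.lim) =
    (\<integral>\<^sup>+X. (\<integral>\<^sup>+y. h ((restrict X {0..<n})(n := y)) \<partial>P n (restrict X {0..<n})) \<partial>PF.lim)"
proof -
  have eP: "eP n \<in> measurable (PiM {0..<n} M) (subprob_algebra (PiM {0..<Suc n} M))"
    by measurable
  have m: "(\<lambda>X. \<integral>\<^sup>+x. h x \<partial>eP n X) \<in> borel_measurable (PiM {0..<n} M)"
    by (rule nn_integral_measurable_subprob_algebra2[OF _ eP]) (use h in measurable)
  have "(\<integral>\<^sup>+X. h (restrict X {0..<Suc n}) \<partial>PF.lim) =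
      (\<integral>\<^sup>+X. h X \<partial>(C 0 n (\<lambda>_. undefined) \<bind> eP n))"
    by (simp add: nn_integral_lim_restrict[OF h])
  also have "\<dots> = (\<integral>\<^sup>+X. (\<integral>\<^sup>+x. h x \<partial>eP n X) \<partial>C 0 n (\<lambda>_. undefined))"
    by (rule nn_integral_bind[OF h])
       (use eP in \<open>simp add: measurable_cong_sets[OF sets_C refl]\<close>)
  also have "\<dots> = (\<integral>\<^sup>+X. (\<integral>\<^sup>+x. h x \<partial>eP n (restrict X {0..<n})) \<partial>PF.lim)"
    by (rule nn_integral_lim_restrict[OF m, symmetric])
  also have "\<dots> = (\<integral>\<^sup>+X. (\<integral>\<^sup>+y. h ((restrict X {0..<n})(n := y)) \<partial>P n (restrict X {0..<n})) \<partial>PF.lim)"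
    by (intro nn_integral_cong nn_integral_eP h) (auto simp: PF.space_lim space_PiM)
  finally show ?thesis .
qed

lemma prob_space_path_measure: "prob_space (path_measure p x)"
proof (rule prob_spaceI)
  interpret C: prob_space "chain.C p x 0 0 (\<lambda>_. undefined)" by (rule chain.prob_space_C) simp
  show "emeasure (path_measure p x) (space (path_measure p x)) = 1"
    using chain.nn_integral_lim_restrict[of "\<lambda>_. 1" 0 p x] C.emeasure_space_1
    by (simp add: path_measure_def)
qed

lemma sets_path_measure [measurable_cong]:
  "sets (path_measure p x) = sets (PiM UNIV (\<lambda>_. count_space UNIV))"
  unfolding path_measure_def by (rule chain.PF.sets_lim)

lemma space_path_measure [simp]: "space (path_measure p x) = UNIV"
  unfolding path_measure_def by (simp add: chain.PF.space_lim space_PiM PiE_UNIV_domain)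

lemma measurable_position [measurable]: "(\<lambda>X. X k) \<in> measurable (path_measure p x) (count_space UNIV)"
  by measurable

lemma nn_integral_start:
  fixes f :: "word \<Rightarrow> ennreal"
  shows "(\<integral>\<^sup>+X. f (X 0) \<partial>path_measure p x) = f x"
proof -
  have "(\<integral>\<^sup>+X. f (restrict X {0..<Suc 0} 0) \<partial>path_measure p x) =
     (\<integral>\<^sup>+X. (\<integral>\<^sup>+y. f (((restrict X {0..<0})(0 := y)) 0) \<partial>chain_kernel p x 0 (restrict X {0..<0})) \<partial>path_measure p x)"
    unfolding path_measure_def by (rule chain.nn_integral_lim_Suc) measurable
  also have "\<dots> = f x"
    using prob_space.emeasure_space_1[OF prob_space_path_measure[of p x]]
    by (simp add: chain_kernel_def nn_integral_return)
  finally show ?thesis by simp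
qed

text \<open>One step of the chain, conditioned on the past: \<open>\<psi>\<close> is an arbitrary functional of the positions
  up to time \<open>k\<close>.\<close>

lemma nn_integral_step:
  fixes f :: "word \<Rightarrow> ennreal" and \<psi> :: "(nat \<Rightarrow> word) \<Rightarrow> ennreal"
  assumes [measurable]: "\<psi> \<in> borel_measurable (PiM {0..<Suc k} (\<lambda>_. count_space UNIV))"
  shows "(\<integral>\<^sup>+X. \<psi> (restrict X {0..<Suc k}) * f (X (Suc k)) \<partial>path_measure p x) =
    (\<integral>\<^sup>+X. \<psi> (restrict X {0..<Suc k}) * (\<integral>\<^sup>+v. f v \<partial>step p (X k)) \<partial>path_measure p x)"
proof -
  let ?h = "\<lambda>X. \<psi> (restrict X {0..<Suc k}) * f (X (Suc k))"
  have [simp]: "{0..<Suc (Suc k)} \<inter> {0..<Suc k} = {0..<Suc k}" by auto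
  have [simp]: "restrict (X(Suc k := y)) {0..<Suc k} = restrict X {0..<Suc k}" for X :: "nat \<Rightarrow> word" and y
    by (auto simp: restrict_def)
  have m: "?h \<in> borel_measurable (PiM {0..<Suc (Suc k)} (\<lambda>_. count_space UNIV))"
    using measurable_compose[OF measurable_restrict_subset[of "{0..<Suc k}" "{0..<Suc (Suc k)}"] assms]
      measurable_compose[OF measurable_component_singleton[of "Suc k" "{0..<Suc (Suc k)}" "\<lambda>_. count_space UNIV"], of f borel]
    by (intro borel_measurable_times_ennreal) auto
  have "(\<integral>\<^sup>+X. ?h (restrict X {0..<Suc (Suc k)}) \<partial>path_measure p x) =
    (\<integral>\<^sup>+X. (\<integral>\<^sup>+y. ?h ((restrict X {0..<Suc k})(Suc k := y))
       \<partial>chain_kernel p x (Suc k) (restrict X {0..<Suc k})) \<partial>path_measure p x)"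
    unfolding path_measure_def by (rule chain.nn_integral_lim_Suc[OF m])
  also have "\<dots> = (\<integral>\<^sup>+X. \<psi> (restrict X {0..<Suc k}) * (\<integral>\<^sup>+v. f v \<partial>step p (X k)) \<partial>path_measure p x)"
    by (simp add: chain_kernel_def nn_integral_cmult)
  finally show ?thesis by simp
qed

lemma expectation_step_const:
  fixes f :: "word \<Rightarrow> real"
  assumes "0 < p" "p < 1/2"
  shows "measure_pmf.expectation (step p (replicate n i)) f = (\<Sum>k\<in>UNIV. f (replicate n i @ [k])) / 3"
proof -
  have c: "replicate n i \<in> const_words n" by (auto simp: const_words_def)
  show ?thesis
    by (subst integral_measure_pmf_real[where A="{replicate n i @ [L1], replicate n i @ [L2], replicate n i @ [L3]}"])
       (auto simp: set_pmf_iff pmf_step[OF assms] trans_prob_const[OF c] UNIV_letter split: if_splits)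
qed

lemma expectation_step_decomp:
  fixes f :: "word \<Rightarrow> real"
  assumes p: "0 < p" "p < 1/2" and ij: "i \<noteq> j" and l: "l \<notin> {i, j}"
  shows "measure_pmf.expectation (step p (\<omega> @ i # replicate (Suc m) j)) f =
    p * f (\<omega> @ j # replicate (Suc m) i) + p * f (\<omega> @ i # replicate m j @ [i])
    + (1 - 2 * p) * f (\<omega> @ i # replicate m j @ [l])"
proof -
  let ?a = "\<omega> @ j # replicate (Suc m) i" and ?b = "\<omega> @ i # replicate m j @ [i]"
    and ?c = "\<omega> @ i # replicate m j @ [l]"
  have "?a \<noteq> ?b" "?a \<noteq> ?c" "?b \<noteq> ?c"
    using ij l by auto
  moreover have "pmf (step p (\<omega> @ i # replicate (Suc m) j)) v = (if v = ?a then p else if v = ?b then p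
        else if v = ?c then 1 - 2 * p else 0)" for v
    unfolding pmf_step[OF p] by (rule trans_prob_decomp[OF ij l refl])
  ultimately show ?thesis
    by (subst integral_measure_pmf_real[where A="{?a, ?b, ?c}"])
       (auto simp: set_pmf_iff split: if_splits simp del: replicate_Suc)
qed

text \<open>Words are compared lexicographically, as numbers in base three.  From a word
  \<open>\<omega> i j\<^bsup>m+1\<^esup>\<close> the chain can always go down: to \<open>\<omega> j i\<^bsup>m+1\<^esup>\<close> if \<open>j < i\<close>, and to
  \<open>\<omega> i j\<^sup>m i\<close> if \<open>i < j\<close>, in both cases with probability \<open>p\<close>.\<close>

primrec digit :: "letter \<Rightarrow> nat" where "digit L1 = 0" | "digit L2 = 1" | "digit L3 = 2"

primrec base3 :: "word \<Rightarrow> nat" where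
  "base3 [] = 0" | "base3 (d # v) = digit d * 3 ^ length v + base3 v"

lemma base3_less: "base3 v < 3 ^ length v"
proof (induction v)
  case (Cons d v)
  thus ?case by (cases d) auto
qed simp

lemma base3_append: "base3 (\<omega> @ v) = base3 \<omega> * 3 ^ length v + base3 v"
  by (induction \<omega>) (auto simp: algebra_simps power_add)

text \<open>The weight of the missing length exceeds every number in base three that occurs, so that a step to
  a longer word also lowers the rank.\<close>

definition word_rank :: "nat \<Rightarrow> word \<Rightarrow> nat" where
  "word_rank n u = (Suc n - length u) * 3 ^ Suc n + base3 u"

lemma word_rank_pos: "length u \<le> n \<Longrightarrow> 0 < word_rank n u"
  by (auto simp: word_rank_def)

lemma word_rank_le: "length u \<le> n \<Longrightarrow> word_rank n u \<le> Suc (Suc n) * 3 ^ Suc n"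
proof -
  assume "length u \<le> n"
  have "base3 u < 3 ^ length u" by (rule base3_less)
  also have "(3::nat) ^ length u \<le> 3 ^ Suc n" using \<open>length u \<le> n\<close> by (intro power_increasing) auto
  finally have "base3 u \<le> 3 ^ Suc n" by simp
  moreover have "(Suc n - length u) * 3 ^ Suc n \<le> Suc n * 3 ^ Suc n" by (intro mult_right_mono) auto
  ultimately show ?thesis by (simp add: word_rank_def)
qed

lemma word_rank_decreases:
  assumes p: "0 < p" "p < 1/2" and u: "length u \<le> n"
  obtains v where "trans_prob p u v \<ge> p / 2" "length v \<le> n \<longrightarrow> word_rank n v < word_rank n u"
proof (cases "\<exists>n. u \<in> const_words n")
  case True
  then obtain k where "u \<in> const_words k" ..
  from trans_prob_const[OF this] have "trans_prob p u (u @ [L1]) \<ge> p / 2" using p by simp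
  moreover have "word_rank n (u @ [L1]) < word_rank n u" if "length (u @ [L1]) \<le> n"
  proof -
    have "base3 (u @ [L1]) < 3 ^ length (u @ [L1])" by (rule base3_less)
    also have "(3::nat) ^ length (u @ [L1]) \<le> 3 ^ Suc n" using that by (intro power_increasing) auto
    finally have "base3 (u @ [L1]) < 3 ^ Suc n" .
    moreover have "Suc n - length u = Suc (Suc n - length (u @ [L1]))" using that by simp
    ultimately show ?thesis unfolding word_rank_def by simp
  qed
  ultimately show ?thesis using that by blast
next
  case False
  hence "\<forall>n. u \<notin> const_words n" by simp
  then obtain \<omega> i j m where ij: "i \<noteq> j" and u': "u = \<omega> @ i # replicate (Suc m) j"
    by (rule decomp_exists)
  obtain l where l: "l \<notin> {i, j}" by (cases i; cases j) auto
  note t = trans_prob_decomp[OF ij l u']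
  show ?thesis
  proof (cases "digit j < digit i")
    case True
    let ?v = "\<omega> @ j # replicate (Suc m) i"
    have "trans_prob p u ?v \<ge> p / 2" unfolding t using p by simp
    moreover have "base3 ?v < base3 u"
    proof -
      have "base3 (replicate (Suc m) i) < 3 ^ Suc m"
        using base3_less[of "replicate (Suc m) i"] by (simp only: length_replicate)
      also have "digit j * 3 ^ Suc m + 3 ^ Suc m \<le> digit i * 3 ^ Suc m"
        using mult_right_mono[of "Suc (digit j)" "digit i" "3 ^ Suc m"] True
        by (simp only: mult_Suc Suc_le_eq add.commute)
      ultimately show ?thesis
        unfolding u' by (simp add: base3_append del: replicate_Suc power_Suc)
    qed
    hence "word_rank n ?v < word_rank n u" using u' by (simp add: word_rank_def)
    ultimately show ?thesis using that by blast
  next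
    case False
    let ?v = "\<omega> @ i # replicate m j @ [i]"
    have "digit i < digit j" using False ij by (cases i; cases j) auto
    have "trans_prob p u ?v \<ge> p / 2" unfolding t using p by simp
    moreover have "word_rank n ?v < word_rank n u"
    proof -
      have "u = (\<omega> @ i # replicate m j) @ [j]" by (simp add: u' replicate_append_same)
      moreover have "?v = (\<omega> @ i # replicate m j) @ [i]" by simp
      ultimately show ?thesis using \<open>digit i < digit j\<close> unfolding word_rank_def
        by (simp only: base3_append) simp
    qed
    ultimately show ?thesis using that by blast
  qed
qed

text \<open>Lyapunov argument: the function \<open>w\<close> that is \<open>\<eta>\<close> to the power of the rank on short words and \<open>1\<close>
  on long ones grows in expectation, and at a short word by at least a fixed amount \<open>c\<close>, since a
  step of probability \<open>p / 2\<close> or more multiplies \<open>w\<close> by at least \<open>1 / \<eta>\<close>.  Its expectation stays below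
  \<open>1\<close>, so the probabilities of being at a short word are summable.\<close>

lemma leaves_short_words:
  assumes p: "0 < p" "p < 1/2"
  shows "(\<lambda>k. measure (path_measure p x) {X. length (X k) \<le> n}) \<longlonglongrightarrow> 0"
proof -
  interpret prob_space "path_measure p x" by (rule prob_space_path_measure)
  \<comment> \<open>A step of probability at least \<open>p / 2 = 2 \<eta>\<close> that multiplies \<open>w\<close> by \<open>1 / \<eta>\<close> contributes \<open>2 w u\<close> to
    its mean: this covers the old value \<open>w u\<close> and leaves \<open>c\<close> as gain.\<close>
  define \<eta> where "\<eta> = p / 4"
  have \<eta>: "0 < \<eta>" "\<eta> < 1" using p by (auto simp: \<eta>_def)
  define w where "w u = (if length u \<le> n then \<eta> ^ word_rank n u else 1)" for u
  have w: "0 \<le> w u" "w u \<le> 1" for u using \<eta> by (auto simp: w_def power_le_one)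
  define c where "c = \<eta> ^ (Suc (Suc n) * 3 ^ Suc n)"
  have c: "0 < c" using \<eta> by (simp add: c_def)
  have stay: "length u > n \<Longrightarrow> (\<integral>\<^sup>+v. ennreal (w v) \<partial>step p u) = 1" for u
  proof -
    assume u: "length u > n"
    have "length v \<ge> length u" if "v \<in> set_pmf (step p u)" for v
      using that unfolding set_pmf_iff pmf_step[OF p] trans_prob_def by (auto split: if_splits)
    hence "(\<integral>\<^sup>+v. ennreal (w v) \<partial>step p u) = (\<integral>\<^sup>+v. 1 \<partial>step p u)"
      by (intro nn_integral_cong_AE) (use u in \<open>fastforce simp: AE_measure_pmf_iff w_def\<close>)
    thus ?thesis by simp
  qed
  have grow: "ennreal (w u) + ennreal c * indicator {u. length u \<le> n} u \<le> (\<integral>\<^sup>+v. ennreal (w v) \<partial>step p u)" for u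
  proof (cases "length u \<le> n")
    case True
    obtain v where v: "trans_prob p u v \<ge> p / 2" "length v \<le> n \<longrightarrow> word_rank n v < word_rank n u"
      by (rule word_rank_decreases[OF p True])
    have "\<eta> ^ word_rank n u \<le> \<eta> * w v"
    proof (cases "length v \<le> n")
      case True
      with v(2) have "Suc (word_rank n v) \<le> word_rank n u" by simp
      hence "\<eta> ^ word_rank n u \<le> \<eta> ^ Suc (word_rank n v)" using \<eta> by (intro power_decreasing) auto
      thus ?thesis using True by (simp add: w_def)
    next
      case F: False
      have "\<eta> ^ word_rank n u \<le> \<eta> ^ 1"
        using \<eta> word_rank_pos[OF True] by (intro power_decreasing) auto
      thus ?thesis using F by (simp add: w_def)
    qed
    moreover have "c \<le> \<eta> ^ word_rank n u"
      unfolding c_def using \<eta> word_rank_le[OF True] by (intro power_decreasing) auto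
    ultimately have "w u + c \<le> 2 * \<eta> * w v" using True by (simp add: w_def)
    also have "\<dots> \<le> w v * pmf (step p u) v"
      using mult_right_mono[OF v(1) w(1)[of v]] by (simp add: pmf_step[OF p] \<eta>_def mult.commute)
    finally have "ennreal (w u + c) \<le> ennreal (w v * pmf (step p u) v)" by (rule ennreal_leI)
    also have "\<dots> = (\<integral>\<^sup>+z. ennreal (w v) * indicator {v} z \<partial>step p u)"
      by (simp add: nn_integral_cmult emeasure_pmf_single ennreal_mult w)
    also have "\<dots> \<le> (\<integral>\<^sup>+v. ennreal (w v) \<partial>step p u)"
      by (intro nn_integral_mono) (auto split: split_indicator)
    finally show ?thesis using True w c by (simp add: ennreal_plus less_imp_le)
  next
    case False
    thus ?thesis using stay by (simp add: w_def)
  qed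
  let ?a = "\<lambda>k. measure (path_measure p x) {X. length (X k) \<le> n}"
  have bound: "ennreal (c * (\<Sum>k<K. ?a k)) \<le> (\<integral>\<^sup>+X. ennreal (w (X K)) \<partial>path_measure p x)" for K
  proof (induction K)
    case (Suc K)
    have "ennreal (c * (\<Sum>k<Suc K. ?a k)) = ennreal (c * (\<Sum>k<K. ?a k)) + ennreal c * ennreal (?a K)"
      using c by (simp add: algebra_simps ennreal_mult ennreal_plus sum_nonneg)
    also have "\<dots> \<le> (\<integral>\<^sup>+X. ennreal (w (X K)) \<partial>path_measure p x)
        + (\<integral>\<^sup>+X. ennreal c * indicator {u. length u \<le> n} (X K) \<partial>path_measure p x)"
    proof (rule add_mono[OF Suc.IH])
      have [measurable]: "{X. length (X K) \<le> n} \<in> sets (path_measure p x)"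
        using measurable_sets[OF measurable_position[of K p x], of "{u. length u \<le> n}"]
        by (simp add: vimage_def)
      have "(\<integral>\<^sup>+X. ennreal c * indicator {u. length u \<le> n} (X K) \<partial>path_measure p x) =
        (\<integral>\<^sup>+X. ennreal c * indicator {X. length (X K) \<le> n} X \<partial>path_measure p x)"
        by (intro nn_integral_cong) (auto split: split_indicator)
      thus "ennreal c * ennreal (?a K) \<le> (\<integral>\<^sup>+X. ennreal c * indicator {u. length u \<le> n} (X K) \<partial>path_measure p x)"
        by (simp add: nn_integral_cmult emeasure_eq_measure)
    qed
    also have "\<dots> = (\<integral>\<^sup>+X. ennreal (w (X K)) + ennreal c * indicator {u. length u \<le> n} (X K) \<partial>path_measure p x)"
      by (rule nn_integral_add[symmetric]) measurable
    also have "\<dots> \<le> (\<integral>\<^sup>+X. (\<integral>\<^sup>+v. ennreal (w v) \<partial>step p (X K)) \<partial>path_measure p x)"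
      by (intro nn_integral_mono grow)
    also have "\<dots> = (\<integral>\<^sup>+X. ennreal (w (X (Suc K))) \<partial>path_measure p x)"
      using nn_integral_step[where \<psi> = "\<lambda>_. 1" and k = K and f = "\<lambda>u. ennreal (w u)"] by simp
    finally show ?case .
  qed simp
  have "(\<Sum>k<K. ?a k) \<le> 1 / c" for K
  proof -
    have "ennreal (c * (\<Sum>k<K. ?a k)) \<le> (\<integral>\<^sup>+X. 1 \<partial>path_measure p x)"
      using w by (intro order.trans[OF bound] nn_integral_mono) auto
    hence "c * (\<Sum>k<K. ?a k) \<le> 1" using emeasure_space_1 by simp
    thus ?thesis using c by (simp add: field_simps)
  qed
  hence "summable ?a" by (intro summableI_nonneg_bounded) auto
  thus ?thesis by (rule summable_LIMSEQ_zero)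
qed

text \<open>Stop the chain at \<open>y\<close>.  Then the values of \<open>g\<close> along the trajectory form a martingale, so
  \<open>g x\<close> is the probability of having reached \<open>y\<close> by time \<open>k\<close> plus a remainder; the remainder lives
  on words of length at most \<open>n\<close> and dies out because the chain leaves them.\<close>

lemma hit_prob_eqI:
  assumes p: "0 < p" "p < 1/2"
    and g: "\<And>u. 0 \<le> g u" "\<And>u. g u \<le> 1" "g y = 1" "\<And>u. n < length u \<Longrightarrow> g u = 0"
    and harm: "\<And>u. u \<noteq> y \<Longrightarrow> measure_pmf.expectation (step p u) g = g u"
  shows "hit_prob p x y = g x"
proof -
  interpret prob_space "path_measure p x" by (rule prob_space_path_measure)
  let ?M = "path_measure p x"
  define N where "N k = {X :: nat \<Rightarrow> word. \<forall>m\<le>k. X m \<noteq> y}" for k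
  have N_sets [measurable]: "N k \<in> sets ?M" for k
  proof -
    have "N k = (\<Inter>m\<in>{..k}. (\<lambda>X. X m) -` (- {y}) \<inter> space ?M)"
      by (auto simp: N_def)
    also have "\<dots> \<in> sets ?M"
      by (intro sets.countable_INT'' sets.finite_INT measurable_sets[OF measurable_position]) auto
    finally show ?thesis .
  qed
  have harm': "(\<integral>\<^sup>+v. ennreal (g v) \<partial>step p u) = ennreal (g u)" if "u \<noteq> y" for u
  proof -
    have "(\<integral>\<^sup>+v. ennreal (g v) \<partial>step p u) = ennreal (measure_pmf.expectation (step p u) g)"
      using g by (intro nn_integral_eq_integral measure_pmf.integrable_const_bound[where B=1]) auto
    thus ?thesis using harm[OF that] by simp
  qed
  \<comment> \<open>\<open>N k\<close> says that \<open>y\<close> has not been visited up to time \<open>k\<close>; as \<open>g y = 1\<close>, \<open>V k\<close> is the value of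
    \<open>g\<close> at the stopped position.\<close>
  define V where "V k X = indicator (N k) X * ennreal (g (X k)) + indicator (- N k) X" for k X
  have inv: "(\<integral>\<^sup>+X. V k X \<partial>?M) = ennreal (g x)" for k
  proof (induction k)
    case 0
    have "V 0 X = ennreal (g (X 0))" for X
      using g(3) by (auto simp: V_def N_def split: split_indicator)
    thus ?case using nn_integral_start[where f = "\<lambda>u. ennreal (g u)"] by simp
  next
    case (Suc k)
    let ?\<psi> = "\<lambda>X. if \<forall>m\<in>{0..<Suc k}. X m \<noteq> y then 1 else 0 :: ennreal"
    have \<psi>: "?\<psi> \<in> borel_measurable (PiM {0..<Suc k} (\<lambda>_. count_space UNIV))"
      by measurable
    have ind: "?\<psi> (restrict X {0..<Suc k}) = indicator (N k) X" for X
      by (auto simp: N_def less_Suc_eq_le split: split_indicator)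
    have "V (Suc k) X = indicator (N k) X * ennreal (g (X (Suc k))) + indicator (- N k) X" for X
      using g(3) by (auto simp: V_def N_def le_Suc_eq split: split_indicator)
    hence "(\<integral>\<^sup>+X. V (Suc k) X \<partial>?M) =
        (\<integral>\<^sup>+X. indicator (N k) X * ennreal (g (X (Suc k))) + indicator (- N k) X \<partial>?M)" by simp
    also have "\<dots> = (\<integral>\<^sup>+X. indicator (N k) X * ennreal (g (X (Suc k))) \<partial>?M) + (\<integral>\<^sup>+X. indicator (- N k) X \<partial>?M)"
      by (rule nn_integral_add) measurable
    also have "(\<integral>\<^sup>+X. indicator (N k) X * ennreal (g (X (Suc k))) \<partial>?M) =
       (\<integral>\<^sup>+X. indicator (N k) X * (\<integral>\<^sup>+v. ennreal (g v) \<partial>step p (X k)) \<partial>?M)"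
      using nn_integral_step[OF \<psi>, where f = "\<lambda>u. ennreal (g u)"] unfolding ind .
    also have "\<dots> = (\<integral>\<^sup>+X. indicator (N k) X * ennreal (g (X k)) \<partial>?M)"
      by (intro nn_integral_cong) (auto simp: N_def harm' split: split_indicator)
    also have "\<dots> + (\<integral>\<^sup>+X. indicator (- N k) X \<partial>?M) = (\<integral>\<^sup>+X. V k X \<partial>?M)"
      unfolding V_def by (rule nn_integral_add[symmetric]) measurable
    finally show ?case using Suc.IH by simp
  qed
  have "(\<lambda>k. prob (- N k)) \<longlonglongrightarrow> prob (\<Union>k. - N k)"
  proof (rule finite_Lim_measure_incseq)
    show "range (\<lambda>k. - N k) \<subseteq> events"
      using sets.compl_sets[OF N_sets] by (auto simp: Compl_eq_Diff_UNIV)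
    show "incseq (\<lambda>k. - N k)"
      unfolding incseq_def N_def by (blast intro: order.trans)
  qed
  moreover have "(\<lambda>k. prob (- N k)) \<longlonglongrightarrow> g x"
  proof (rule tendsto_sandwich[OF always_eventually always_eventually])
    let ?a = "\<lambda>k. prob {X. length (X k) \<le> n}"
    have comp: "- N k \<in> sets ?M" for k
      using sets.compl_sets[OF N_sets, of k] by (simp add: Compl_eq_Diff_UNIV)
    have H: "(\<integral>\<^sup>+X. indicator (- N k) X \<partial>?M) = ennreal (prob (- N k))" for k
      using comp by (simp add: emeasure_eq_measure)
    have split: "ennreal (g x) = (\<integral>\<^sup>+X. indicator (N k) X * ennreal (g (X k)) \<partial>?M) + ennreal (prob (- N k))" for k
      unfolding inv[symmetric, of k] V_def H[symmetric] by (rule nn_integral_add) measurable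
    show "\<forall>k. prob (- N k) \<le> g x"
    proof
      fix k
      have "ennreal (prob (- N k)) \<le> ennreal (g x)" by (subst split[of k]) simp
      thus "prob (- N k) \<le> g x" using g(1) by simp
    qed
    show "\<forall>k. g x - ?a k \<le> prob (- N k)"
    proof
      fix k
      have [measurable]: "{X. length (X k) \<le> n} \<in> sets ?M"
        using measurable_sets[OF measurable_position[of k p x], of "{u. length u \<le> n}"]
        by (simp add: vimage_def)
      have "(\<integral>\<^sup>+X. indicator (N k) X * ennreal (g (X k)) \<partial>?M) \<le>
          (\<integral>\<^sup>+X. indicator {X. length (X k) \<le> n} X \<partial>?M)"
        using g by (intro nn_integral_mono) (auto simp: not_le split: split_indicator)
      also have "\<dots> = ennreal (?a k)" by (simp add: emeasure_eq_measure)
      finally have "ennreal (g x) \<le> ennreal (?a k) + ennreal (prob (- N k))"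
        by (subst split[of k]) (rule add_right_mono)
      hence "g x \<le> ?a k + prob (- N k)"
        by (simp add: ennreal_plus[symmetric] del: ennreal_plus)
      thus "g x - ?a k \<le> prob (- N k)" by simp
    qed
    show "(\<lambda>k. g x - ?a k) \<longlonglongrightarrow> g x"
      using tendsto_diff[OF tendsto_const leaves_short_words[OF p]] by simp
  qed simp
  ultimately have "prob (\<Union>k. - N k) = g x" by (rule LIMSEQ_unique)
  moreover have "(\<Union>k. - N k) = {X. \<exists>k. X k = y}" by (auto simp: N_def)
  ultimately show ?thesis by (simp add: hit_prob_def)
qed

section \<open>Extending corner values into smaller triangles\<close>

lemma sum_letter: "(\<Sum>k\<in>UNIV. f k) = f L1 + f L2 + f L3" for f :: "letter \<Rightarrow> 'a::comm_monoid_add"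
  by (simp add: UNIV_letter add.assoc)

lemma all_letter: "(\<forall>i. Q i) \<longleftrightarrow> Q L1 \<and> Q L2 \<and> Q L3"
  by (metis letter.exhaust)

lemma letter_sum_distinct:
  fixes f :: "letter \<Rightarrow> real"
  assumes "distinct [i, j, l]" shows "(\<Sum>k\<in>UNIV. f k) = f i + f j + f l"
  using assms by (cases i; cases j; cases l) (simp_all add: sum_letter)

text \<open>The corner values of the subtriangle at corner \<open>j\<close>.  The sum serves to name the value at the third
  letter without choosing it: the factor of \<open>\<beta>\<close> is \<open>a l - a j\<close> for the letter \<open>l\<close> different from
  \<open>i\<close> and \<open>j\<close>, see \<open>refine_other\<close>.\<close>

definition refine :: "real \<Rightarrow> real \<Rightarrow> letter \<Rightarrow> (letter \<Rightarrow> real) \<Rightarrow> letter \<Rightarrow> real" where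
  "refine \<alpha> \<beta> j a i = (if i = j then a j
     else a j + \<alpha> * (a i - a j) + \<beta> * ((\<Sum>k\<in>UNIV. a k) - a i - 2 * a j))"

lemma refine_same [simp]: "refine \<alpha> \<beta> j a j = a j"
  by (simp add: refine_def)

lemma refine_other:
  assumes "distinct [i, j, l]"
  shows "refine \<alpha> \<beta> j a i = a j + \<alpha> * (a i - a j) + \<beta> * (a l - a j)"
  using assms by (cases i; cases j; cases l) (simp_all add: refine_def sum_letter)

lemma third_letter:
  fixes i j :: letter
  assumes "i \<noteq> j"
  obtains l where "distinct [i, j, l]"
  using assms by (cases i; cases j) (auto intro: that[of L1] that[of L2] that[of L3])

lemma refine_affine: "refine \<alpha> \<beta> j (\<lambda>k. s + t * a k) = (\<lambda>k. s + t * refine \<alpha> \<beta> j a k)"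
  by (rule ext) (simp add: refine_def sum_letter algebra_simps)

lemma refine_between:
  assumes "0 \<le> \<alpha>" "0 \<le> \<beta>" "\<alpha> + \<beta> \<le> 1" and a: "\<And>k. L \<le> a k \<and> a k \<le> U"
  shows "L \<le> refine \<alpha> \<beta> j a i \<and> refine \<alpha> \<beta> j a i \<le> U"
proof (cases "i = j")
  case False
  then obtain l where l: "distinct [i, j, l]" by (rule third_letter)
  have eq: "refine \<alpha> \<beta> j a i = (1 - \<alpha> - \<beta>) * a j + \<alpha> * a i + \<beta> * a l"
    unfolding refine_other[OF l] by (simp add: algebra_simps)
  have "(1 - \<alpha> - \<beta>) * L + \<alpha> * L + \<beta> * L \<le> refine \<alpha> \<beta> j a i"
    unfolding eq using assms by (intro add_mono mult_left_mono) auto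
  moreover have "refine \<alpha> \<beta> j a i \<le> (1 - \<alpha> - \<beta>) * U + \<alpha> * U + \<beta> * U"
    unfolding eq using assms by (intro add_mono mult_left_mono) auto
  ultimately show ?thesis by (simp add: algebra_simps)
qed (use a in simp)

text \<open>The corner values of the triangle addressed by \<open>\<omega>\<close> under the classical extension rule.\<close>

definition extend :: "word \<Rightarrow> (letter \<Rightarrow> real) \<Rightarrow> letter \<Rightarrow> real" where
  "extend \<omega> a = foldl (\<lambda>b j. refine (2/5) (1/5) j b) a \<omega>"

lemma extend_Nil [simp]: "extend [] a = a"
  and extend_Cons [simp]: "extend (j # \<omega>) a = extend \<omega> (refine (2/5) (1/5) j a)"
  and extend_append: "extend (\<omega> @ \<omega>') a = extend \<omega>' (extend \<omega> a)"
  by (simp_all add: extend_def)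

lemma extend_between:
  assumes "\<And>k. L \<le> a k \<and> a k \<le> U" shows "L \<le> extend \<omega> a i \<and> extend \<omega> a i \<le> U"
  using assms
proof (induction \<omega> arbitrary: a)
  case (Cons j \<omega>)
  show ?case unfolding extend_Cons
    by (rule Cons.IH, rule refine_between) (use Cons.prems in auto)
qed simp

text \<open>Each of the maps \<open>refine (2/5) (1/5) j\<close> contracts the differences of corner values by
  the factor \<open>3/5\<close>, which is the resistance scaling factor of the gasket.\<close>

lemma extend_contracts:
  assumes "\<And>i j. \<bar>a i - a j\<bar> \<le> D"
  shows "\<bar>extend \<omega> a i - extend \<omega> a j\<bar> \<le> (3/5) ^ length \<omega> * D"
  using assms
proof (induction \<omega> arbitrary: a D)
  case (Cons k \<omega>)
  have "\<bar>refine (2/5) (1/5) k a i - refine (2/5) (1/5) k a j\<bar> \<le> 3/5 * D" for i j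
    using Cons.prems[of L1 L2] Cons.prems[of L1 L3] Cons.prems[of L2 L3]
    by (cases i; cases j; cases k) (simp_all add: refine_def sum_letter field_simps abs_le_iff)
  from Cons.IH[OF this] show ?case by (simp add: mult_ac)
qed simp

lemma trunc_Suc: "trunc x (Suc n) = trunc x n @ [x n]"
  by (simp add: trunc_def)

lemma length_trunc [simp]: "length (trunc x n) = n"
  by (simp add: trunc_def)

lemma trunc_add: "trunc x (n + k) = trunc x n @ trunc (\<lambda>m. x (n + m)) k"
  by (induction k) (simp_all add: trunc_Suc trunc_def)

text \<open>By the contraction the three corner values converge to a common limit, so the choice of the
  corner \<open>L1\<close> is immaterial (\<open>extend_tendsto\<close>).\<close>

definition bdry_val :: "(letter \<Rightarrow> real) \<Rightarrow> inf_word \<Rightarrow> real" where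
  "bdry_val a x = lim (\<lambda>n. extend (trunc x n) a L1)"

lemma spread_exists:
  fixes a :: "letter \<Rightarrow> real"
  shows "\<exists>D>0. \<forall>i j. \<bar>a i - a j\<bar> \<le> D"
proof (intro exI conjI allI)
  let ?D = "\<bar>a L1 - a L2\<bar> + \<bar>a L1 - a L3\<bar> + \<bar>a L2 - a L3\<bar> + 1"
  show "\<bar>a i - a j\<bar> \<le> ?D" for i j by (cases i; cases j) auto
qed auto

lemma bdry_val_close:
  assumes "\<And>i j. \<bar>a i - a j\<bar> \<le> D"
  shows "\<bar>bdry_val a x - extend (trunc x n) a i\<bar> \<le> (3/5) ^ n * D"
proof -
  let ?e = "\<lambda>n. extend (trunc x n) a"
  have *: "\<bar>?e (n + k) i - ?e n j\<bar> \<le> (3/5) ^ n * D" for n k i j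
  proof -
    have "?e n j - (3/5) ^ n * D \<le> ?e n i \<and> ?e n i \<le> ?e n j + (3/5) ^ n * D" for i
      using extend_contracts[of a D "trunc x n" i j, OF assms] by (simp add: abs_le_iff)
    from extend_between[of "?e n j - (3/5) ^ n * D" "?e n" "?e n j + (3/5) ^ n * D", OF this, of "trunc (\<lambda>m. x (n + m)) k" i] show ?thesis
      by (simp add: trunc_add extend_append abs_le_iff)
  qed
  have "Cauchy (\<lambda>n. ?e n L1)"
  proof (rule metric_CauchyI)
    fix \<epsilon> :: real assume \<epsilon>: "0 < \<epsilon>"
    have "(\<lambda>n. (3/5) ^ n * D) \<longlonglongrightarrow> 0 * D" by (intro tendsto_mult LIMSEQ_power_zero) auto
    hence "\<forall>\<^sub>F n in sequentially. (3/5) ^ n * D < \<epsilon>/2"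
      using \<epsilon> by (intro order_tendstoD) auto
    then obtain N where N: "(3/5) ^ N * D < \<epsilon>/2" by (auto simp: eventually_sequentially)
    have "dist (?e m L1) (?e N L1) < \<epsilon>/2" if "N \<le> m" for m
      using *[of N "m - N" L1 L1] N that by (simp add: dist_real_def)
    thus "\<exists>M. \<forall>m\<ge>M. \<forall>n\<ge>M. dist (?e m L1) (?e n L1) < \<epsilon>"
      by (intro exI[of _ N] allI impI) (metis dist_triangle_half_l dist_commute)
  qed
  hence "convergent (\<lambda>n. ?e n L1)" by (rule Cauchy_convergent)
  hence "(\<lambda>n. ?e n L1) \<longlonglongrightarrow> bdry_val a x"
    unfolding bdry_val_def by (simp add: convergent_LIMSEQ_iff)
  hence "(\<lambda>k. ?e (n + k) L1) \<longlonglongrightarrow> bdry_val a x"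
    using LIMSEQ_ignore_initial_segment[of _ _ n] by (simp add: add.commute)
  hence "(\<lambda>k. \<bar>?e (n + k) L1 - ?e n i\<bar>) \<longlonglongrightarrow> \<bar>bdry_val a x - ?e n i\<bar>"
    by (intro tendsto_intros)
  thus ?thesis by (rule tendsto_upperbound) (use * in auto)
qed

lemma null_if_geometric_bound:
  fixes f :: "nat \<Rightarrow> real"
  assumes "\<And>n. \<bar>f n\<bar> \<le> c ^ n * D" "0 \<le> c" "c < 1"
  shows "f \<longlonglongrightarrow> 0"
proof (rule Lim_null_comparison)
  show "\<forall>\<^sub>F n in sequentially. norm (f n) \<le> c ^ n * D" using assms(1) by simp
  have "(\<lambda>n. c ^ n * D) \<longlonglongrightarrow> 0 * D"
    using assms by (intro tendsto_mult tendsto_const LIMSEQ_power_zero) auto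
  thus "(\<lambda>n. c ^ n * D) \<longlonglongrightarrow> 0" by simp
qed

lemma bdry_val_eqI:
  assumes "(\<lambda>n. extend (trunc x n) a (i n)) \<longlonglongrightarrow> r"
  shows "bdry_val a x = r"
proof -
  from spread_exists[of a] obtain D where D: "0 < D \<and> (\<forall>i j. \<bar>a i - a j\<bar> \<le> D)" ..
  have "(\<lambda>n. bdry_val a x - extend (trunc x n) a (i n)) \<longlonglongrightarrow> 0"
    by (rule null_if_geometric_bound[OF bdry_val_close[OF D[THEN conjunct2, rule_format]]]) auto
  moreover have "(\<lambda>n. bdry_val a x - extend (trunc x n) a (i n)) \<longlonglongrightarrow> bdry_val a x - r"
    by (intro tendsto_intros assms)
  ultimately have "0 = bdry_val a x - r" by (rule LIMSEQ_unique)
  thus ?thesis by simp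
qed

lemma extend_tendsto: "(\<lambda>n. extend (trunc x n) a i) \<longlonglongrightarrow> bdry_val a x"
proof -
  from spread_exists[of a] obtain D where D: "0 < D \<and> (\<forall>i j. \<bar>a i - a j\<bar> \<le> D)" ..
  have "(\<lambda>n. bdry_val a x - extend (trunc x n) a i) \<longlonglongrightarrow> 0"
    by (rule null_if_geometric_bound[OF bdry_val_close[OF D[THEN conjunct2, rule_format]]]) auto
  from tendsto_diff[OF tendsto_const[of "bdry_val a x"] this] show ?thesis by simp
qed

section \<open>The equations on one level of the chain\<close>

locale gasket_chain =
  fixes p :: real
  assumes p: "0 < p" "p < 1 / 2"
begin

text \<open>With conductances \<open>P\<close> and \<open>Q\<close> inside the blocks and \<open>p\<close> between them, \<open>split_near\<close> and
  \<open>split_far\<close> are the coefficients \<open>\<alpha>\<close> and \<open>\<beta>\<close> for which the values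
  \<open>a\<^sub>i + \<alpha> (a\<^sub>j - a\<^sub>i) + \<beta> (a\<^sub>l - a\<^sub>i)\<close> at the six inner corners of the three blocks are in
  equilibrium.\<close>

definition split_near :: "real \<Rightarrow> real \<Rightarrow> real" where
  "split_near P Q = p * (P + Q) / (p * (2 * P + 3 * Q) + P * (P + 2 * Q))"

definition split_far :: "real \<Rightarrow> real \<Rightarrow> real" where
  "split_far P Q = p * Q / (p * (2 * P + 3 * Q) + P * (P + 2 * Q))"

text \<open>From a corner \<open>\<omega> j\<^bsup>n+1\<^esup>\<close> of a block of words \<open>\<omega> v\<close> with \<open>v\<close> of length \<open>n + 1\<close> the chain steps into
  the block with probability \<open>p\<close> towards one letter and \<open>1 - 2 p\<close> towards the other.  The pair
  \<open>(P, Q)\<close> is the resulting effective pull towards the two other corners of the block.  In a block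
  one letter longer, \<open>\<alpha>\<close> and \<open>\<beta>\<close> express the inner corner values by the outer ones, which gives the
  recursion.\<close>

primrec weights :: "nat \<Rightarrow> real \<times> real" where
  "weights 0 = (p, 1 - 2 * p)"
| "weights (Suc n) = (case weights n of (P, Q) \<Rightarrow>
     (split_near P Q * P + split_far P Q * Q, split_far P Q * P + split_near P Q * Q))"

definition "P n = fst (weights n)"
definition "Q n = snd (weights n)"
definition "\<alpha> n = split_near (P n) (Q n)"
definition "\<beta> n = split_far (P n) (Q n)"
definition "denom n = p * (2 * P n + 3 * Q n) + P n * (P n + 2 * Q n)"

lemma PQ_0: "P 0 = p" "Q 0 = 1 - 2 * p"
  and PQ_Suc: "P (Suc n) = \<alpha> n * P n + \<beta> n * Q n" "Q (Suc n) = \<beta> n * P n + \<alpha> n * Q n"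
  by (simp_all add: P_def Q_def \<alpha>_def \<beta>_def split: prod.split)

lemma \<alpha>_eq: "\<alpha> n = p * (P n + Q n) / denom n" and \<beta>_eq: "\<beta> n = p * Q n / denom n"
  by (simp_all add: \<alpha>_def \<beta>_def denom_def split_near_def split_far_def)

lemma PQ_pos: "0 < P n \<and> 0 < Q n"
proof (induction n)
  case 0
  show ?case using p by (simp add: PQ_0)
next
  case (Suc n)
  hence "0 < denom n" unfolding denom_def using p by (intro add_pos_pos mult_pos_pos) auto
  hence "0 < \<alpha> n" "0 < \<beta> n" unfolding \<alpha>_eq \<beta>_eq using Suc p by (auto intro!: divide_pos_pos mult_pos_pos add_pos_pos)
  thus ?case using Suc by (auto simp: PQ_Suc intro!: add_pos_pos mult_pos_pos)
qed

lemma P_pos: "0 < P n" and Q_pos: "0 < Q n"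
  using PQ_pos by auto

lemma denom_pos: "0 < denom n"
  unfolding denom_def using p P_pos Q_pos by (intro add_pos_pos mult_pos_pos) auto

lemma \<alpha>\<beta>_pos: "0 < \<alpha> n" "0 < \<beta> n"
  unfolding \<alpha>_eq \<beta>_eq using p denom_pos P_pos Q_pos by (auto intro!: divide_pos_pos mult_pos_pos add_pos_pos)

lemma \<alpha>\<beta>_le: "\<alpha> n + \<beta> n \<le> 2 / 3"
proof -
  have "3 * (p * (P n + 2 * Q n)) \<le> 2 * denom n"
    using mult_pos_pos[OF p(1) P_pos[of n]] mult_pos_pos[OF P_pos[of n] Q_pos[of n]]
      mult_pos_pos[OF P_pos[of n] P_pos[of n]]
    unfolding denom_def ring_distribs mult.assoc by (simp add: mult.left_commute)
  moreover have "\<alpha> n + \<beta> n = p * (P n + 2 * Q n) / denom n"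
    by (simp add: \<alpha>_eq \<beta>_eq add_divide_distrib[symmetric] algebra_simps)
  ultimately show ?thesis using denom_pos[of n] by (simp only: pos_divide_le_eq)
qed

text \<open>Equilibrium at the inner corner \<open>ij\<close> for all corner values amounts to the two identities
  \<open>P \<beta> = Q (\<alpha> - \<beta>)\<close> and \<open>p (1 - 2 \<alpha> - \<beta>) = P \<alpha> + Q (\<alpha> - \<beta>)\<close>, which determine \<open>\<alpha>\<close> and \<open>\<beta>\<close>.\<close>

lemma refine_balance:
  fixes n :: nat
  assumes d: "distinct [i, j, l]"
  defines "b \<equiv> refine (\<alpha> n) (\<beta> n)"
  shows "p * (b j a i - b i a j) + P n * (a i - b i a j) + Q n * (b i a l - b i a j) = 0"
proof -
  have e: "\<alpha> n * denom n = p * (P n + Q n)" "\<beta> n * denom n = p * Q n"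
    using denom_pos[of n] by (simp_all add: \<alpha>_eq \<beta>_eq)
  have "denom n * (P n * \<beta> n) = denom n * (Q n * (\<alpha> n - \<beta> n))"
    using e by algebra
  hence 1: "P n * \<beta> n = Q n * (\<alpha> n - \<beta> n)" using denom_pos[of n] by simp
  have "denom n * (p * (1 - 2 * \<alpha> n - \<beta> n)) = denom n * (P n * \<alpha> n + Q n * (\<alpha> n - \<beta> n))"
    using e denom_def[of n] by algebra
  hence 2: "p * (1 - 2 * \<alpha> n - \<beta> n) = P n * \<alpha> n + Q n * (\<alpha> n - \<beta> n)" using denom_pos[of n] by simp
  have b: "b j a i = a j + \<alpha> n * (a i - a j) + \<beta> n * (a l - a j)"
    "b i a j = a i + \<alpha> n * (a j - a i) + \<beta> n * (a l - a i)"
    "b i a l = a i + \<alpha> n * (a l - a i) + \<beta> n * (a j - a i)"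
    unfolding b_def using d by (auto intro!: refine_other)
  show ?thesis unfolding b using 1 2 by algebra
qed

text \<open>The solution on the words of one length with corner values \<open>a\<close>.  The index of the coefficients
  is the length of the remaining word minus one.  The value at the empty word is the one that
  averaging over the three letters requires.\<close>

fun val :: "word \<Rightarrow> (letter \<Rightarrow> real) \<Rightarrow> real" where
  "val [] a = (\<Sum>k\<in>UNIV. a k) / 3"
| "val [j] a = a j"
| "val (j # k # v) a = val (k # v) (refine (\<alpha> (length v)) (\<beta> (length v)) j a)"

lemma val_Cons: "v \<noteq> [] \<Longrightarrow> val (j # v) a = val v (refine (\<alpha> (length v - 1)) (\<beta> (length v - 1)) j a)"
  by (cases v) auto

lemma val_corner: "val (replicate (Suc m) j) a = a j"
  by (induction m arbitrary: a) (simp_all add: val_Cons)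

lemma val_affine: "val v (\<lambda>k. s + t * a k) = s + t * val v a"
  by (induction v a rule: val.induct) (simp_all add: refine_affine sum_letter algebra_simps add_divide_distrib)

lemma val_between:
  assumes "\<And>k. L \<le> a k \<and> a k \<le> U"
  shows "L \<le> val v a \<and> val v a \<le> U"
  using assms
proof (induction v a rule: val.induct)
  case (1 a)
  have "3 * L \<le> a L1 + a L2 + a L3" "a L1 + a L2 + a L3 \<le> 3 * U"
    using 1[of L1] 1[of L2] 1[of L3] by linarith+
  thus ?case by (simp add: sum_letter)
next
  case (3 j k v a)
  show ?case unfolding val.simps
    by (rule 3(1), rule refine_between)
       (use 3(2) \<alpha>\<beta>_pos[of "length v"] \<alpha>\<beta>_le[of "length v"] in auto)
qed auto

text \<open>The two mates of \<open>j\<^bsup>m+1\<^esup>\<close> in its smallest triangle enter with weights \<open>p\<close> and \<open>1 - 2 p\<close>, as in the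
  transitions out of the corner; in terms of the corner values of the whole block this weighted sum
  has the coefficients \<open>P m\<close> and \<open>Q m\<close>.\<close>

lemma val_next_to_corner:
  assumes d: "distinct [i, j, l]"
  shows "p * val (replicate m j @ [i]) a + (1 - 2 * p) * val (replicate m j @ [l]) a =
    (1 - p) * a j + P m * (a i - a j) + Q m * (a l - a j)"
proof (induction m arbitrary: a)
  case 0
  show ?case by (simp add: PQ_0 algebra_simps)
next
  case (Suc m)
  have "refine (\<alpha> m) (\<beta> m) j a i = a j + \<alpha> m * (a i - a j) + \<beta> m * (a l - a j)"
    "refine (\<alpha> m) (\<beta> m) j a l = a j + \<alpha> m * (a l - a j) + \<beta> m * (a i - a j)"
    using d by (auto intro!: refine_other)
  note b = this
  have "val (replicate (Suc m) j @ [k]) a = val (replicate m j @ [k]) (refine (\<alpha> m) (\<beta> m) j a)" for k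
    by (simp add: val_Cons)
  thus ?case using Suc.IH[of "refine (\<alpha> m) (\<beta> m) j a", unfolded b refine_same]
    by (simp only: PQ_Suc) (simp add: algebra_simps)
qed

text \<open>The word \<open>i j\<^bsup>m+1\<^esup>\<close> is a corner of its block, and its three transitions reduce by
  \<open>val_next_to_corner\<close> to the equilibrium at an inner corner.\<close>

lemma val_harmonic_outer:
  assumes d: "distinct [i, j, l]"
  shows "val (i # replicate (Suc m) j) a = p * val (j # replicate (Suc m) i) a
     + p * val (i # replicate m j @ [i]) a + (1 - 2 * p) * val (i # replicate m j @ [l]) a"
proof -
  let ?b = "refine (\<alpha> m) (\<beta> m)"
  have "val (i # replicate (Suc m) j) a = ?b i a j" "val (j # replicate (Suc m) i) a = ?b j a i"
    using val_Cons[of "replicate (Suc m) j" i a] val_Cons[of "replicate (Suc m) i" j a]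
    by (simp_all only: val_corner length_replicate) simp_all
  moreover have "val (i # replicate m j @ [k]) a = val (replicate m j @ [k]) (?b i a)" for k
    by (simp add: val_Cons)
  ultimately show ?thesis
    using val_next_to_corner[OF d, of m "?b i a"] refine_balance[OF d, of m a]
    by (simp add: algebra_simps)
qed

lemma decay_le: "P n + Q n \<le> (1 - p) * (2 / 3) ^ n"
proof (induction n)
  case (Suc n)
  have "P (Suc n) + Q (Suc n) = (\<alpha> n + \<beta> n) * (P n + Q n)"
    by (simp add: PQ_Suc algebra_simps)
  also have "\<dots> \<le> 2 / 3 * (P n + Q n)"
    using \<alpha>\<beta>_le[of n] P_pos[of n] Q_pos[of n] by (intro mult_right_mono) auto
  also have "\<dots> \<le> 2 / 3 * ((1 - p) * (2 / 3) ^ n)"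
    by (intro mult_left_mono Suc.IH) auto
  finally show ?case by (simp add: mult_ac)
qed (simp add: PQ_0)

lemma P_tendsto_0: "P \<longlonglongrightarrow> 0"
proof (rule null_if_geometric_bound)
  show "\<bar>P n\<bar> \<le> (2 / 3) ^ n * (1 - p)" for n
    using decay_le[of n] P_pos[of n] Q_pos[of n] by (simp add: mult.commute)
qed auto

text \<open>The ratio of the two weights evolves autonomously by \<open>\<rho>' = (\<rho>\<^sup>2 + \<rho> + 1) / (2 \<rho> + 1)\<close>, whose
  only positive fixed point is \<open>1\<close>.\<close>

lemma ratio_Suc: "P (Suc n) / Q (Suc n) - 1 = (P n / Q n - 1) * (P n / (2 * P n + Q n))"
proof -
  have e: "\<alpha> n * denom n = p * (P n + Q n)" "\<beta> n * denom n = p * Q n"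
    using denom_pos[of n] by (simp_all add: \<alpha>_eq \<beta>_eq)
  have "\<alpha> n * Q n = \<beta> n * (P n + Q n)"
    by (simp add: \<alpha>_eq \<beta>_eq)
  hence a: "\<alpha> n = \<beta> n * (P n + Q n) / Q n" using Q_pos[of n] by (simp add: field_simps)
  have "P (Suc n) = \<beta> n / Q n * (P n ^ 2 + P n * Q n + Q n ^ 2)"
    using Q_pos[of n] unfolding PQ_Suc a by (simp add: field_simps power2_eq_square)
  moreover have "Q (Suc n) = \<beta> n / Q n * (Q n * (2 * P n + Q n))"
    using Q_pos[of n] unfolding PQ_Suc a by (simp add: field_simps power2_eq_square)
  ultimately have q: "P (Suc n) / Q (Suc n) = (P n ^ 2 + P n * Q n + Q n ^ 2) / (Q n * (2 * P n + Q n))"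
    using \<alpha>\<beta>_pos[of n] Q_pos[of n] by simp
  have nz: "Q n \<noteq> 0" "2 * P n + Q n \<noteq> 0" using P_pos[of n] Q_pos[of n] by linarith+
  have "P n / Q n - 1 = (P n - Q n) / Q n" using nz by (simp add: diff_divide_distrib)
  hence "(P n / Q n - 1) * (P n / (2 * P n + Q n)) = ((P n - Q n) * P n) / (Q n * (2 * P n + Q n))"
    by simp
  also have "(P n - Q n) * P n = (P n ^ 2 + P n * Q n + Q n ^ 2) - Q n * (2 * P n + Q n)"
    by (simp add: algebra_simps power2_eq_square)
  also have "\<dots> / (Q n * (2 * P n + Q n)) =
      (P n ^ 2 + P n * Q n + Q n ^ 2) / (Q n * (2 * P n + Q n)) - 1"
    using nz by (simp only: diff_divide_distrib) simp
  finally show ?thesis by (simp only: q)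
qed

lemma ratio_tendsto_1: "(\<lambda>n. P n / Q n) \<longlonglongrightarrow> 1"
proof -
  let ?c = "\<bar>P 0 / Q 0 - 1\<bar>"
  have "\<bar>P n / Q n - 1\<bar> \<le> (1 / 2) ^ n * ?c" for n
  proof (induction n)
    case (Suc n)
    have "P n / (2 * P n + Q n) \<le> 1 / 2" "0 \<le> P n / (2 * P n + Q n)"
      using P_pos[of n] Q_pos[of n] by (simp_all add: field_simps)
    hence "\<bar>P n / (2 * P n + Q n)\<bar> \<le> 1 / 2" by (simp only: abs_of_nonneg)
    hence "\<bar>P (Suc n) / Q (Suc n) - 1\<bar> \<le> \<bar>P n / Q n - 1\<bar> * (1 / 2)"
      unfolding ratio_Suc abs_mult by (rule mult_left_mono) simp
    also have "\<dots> \<le> ((1 / 2) ^ n * ?c) * (1 / 2)" by (intro mult_right_mono Suc.IH) auto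
    finally show ?case by simp
  qed simp
  hence "(\<lambda>n. P n / Q n - 1) \<longlonglongrightarrow> 0"
    by (rule null_if_geometric_bound) auto
  thus ?thesis by (rule LIM_zero_cancel)
qed

lemma \<alpha>_tendsto: "\<alpha> \<longlonglongrightarrow> 2 / 5" and \<beta>_tendsto: "\<beta> \<longlonglongrightarrow> 1 / 5"
proof -
  let ?r = "\<lambda>n. P n / Q n"
  let ?d = "\<lambda>n. p * (2 * ?r n + 3) + P n * (?r n + 2)"
  have d: "denom n = Q n * ?d n" for n
    using Q_pos[of n] by (simp add: denom_def field_simps)
  have \<alpha>: "\<alpha> n = p * (?r n + 1) / ?d n" for n
  proof -
    have "p * (P n + Q n) = Q n * (p * (?r n + 1))" using Q_pos[of n] by (simp add: field_simps)
    hence "\<alpha> n = (Q n * (p * (?r n + 1))) / (Q n * ?d n)" by (simp only: \<alpha>_eq d)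
    also have "\<dots> = p * (?r n + 1) / ?d n"
      by (rule mult_divide_mult_cancel_left) (use Q_pos[of n] in linarith)
    finally show ?thesis .
  qed
  have "(\<lambda>n. p * (?r n + 1) / ?d n) \<longlonglongrightarrow> p * (1 + 1) / (p * (2 * 1 + 3) + 0 * (1 + 2))"
    using p by (intro tendsto_intros ratio_tendsto_1 P_tendsto_0) auto
  hence "\<alpha> \<longlonglongrightarrow> p * (1 + 1) / (p * (2 * 1 + 3) + 0 * (1 + 2))"
    unfolding \<alpha>[symmetric] .
  thus "\<alpha> \<longlonglongrightarrow> 2 / 5" using p by simp
  have \<beta>: "\<beta> n = p / ?d n" for n
    unfolding \<beta>_eq d using Q_pos[of n] by simp
  have "(\<lambda>n. p / ?d n) \<longlonglongrightarrow> p / (p * (2 * 1 + 3) + 0 * (1 + 2))"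
    using p by (intro tendsto_intros ratio_tendsto_1 P_tendsto_0) auto
  hence "\<beta> \<longlonglongrightarrow> p / (p * (2 * 1 + 3) + 0 * (1 + 2))"
    unfolding \<beta>[symmetric] .
  thus "\<beta> \<longlonglongrightarrow> 1 / 5" using p by simp
qed

text \<open>Reading off the prefix \<open>\<omega>\<close> only replaces the corner values by others, which depend on the
  remaining length \<open>k\<close> and converge to those of the classical rule.  The corner values
  \<open>A k\<close> vary with \<open>k\<close> because the induction on \<open>\<omega>\<close> changes them.\<close>

lemma val_prefix:
  assumes "\<And>i. (\<lambda>k. A k i) \<longlonglongrightarrow> a i"
  shows "\<exists>B. (\<forall>i. (\<lambda>k. B k i) \<longlonglongrightarrow> extend \<omega> a i)
     \<and> (\<forall>v. v \<noteq> [] \<longrightarrow> val (\<omega> @ v) (A (length v)) = val v (B (length v)))"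
  using assms
proof (induction \<omega> arbitrary: A a)
  case Nil
  thus ?case by (intro exI[of _ A]) simp
next
  case (Cons j \<omega>)
  define A' where "A' k = refine (\<alpha> (length \<omega> + k - 1)) (\<beta> (length \<omega> + k - 1)) j (A k)" for k
  have idx: "filterlim (\<lambda>k. length \<omega> + k - 1) sequentially sequentially"
    by (rule filterlim_at_top_mono[OF filterlim_minus_const_nat_at_top[of 1]])
       (simp add: diff_le_mono)
  have "(\<lambda>k. A' k i) \<longlonglongrightarrow> refine (2/5) (1/5) j a i" for i
  proof (cases "i = j")
    case False
    thus ?thesis unfolding A'_def refine_def if_not_P[OF False]
      by (intro tendsto_intros Cons.prems filterlim_compose[OF \<alpha>_tendsto idx]
          filterlim_compose[OF \<beta>_tendsto idx])
  qed (simp add: A'_def Cons.prems)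
  from Cons.IH[of A', OF this] obtain B where
    B: "\<forall>i. (\<lambda>k. B k i) \<longlonglongrightarrow> extend \<omega> (refine (2/5) (1/5) j a) i"
      "\<forall>v. v \<noteq> [] \<longrightarrow> val (\<omega> @ v) (A' (length v)) = val v (B (length v))" by blast
  show ?case
    using B by (intro exI[of _ B]) (auto simp: val_Cons A'_def)
qed

text \<open>For a fixed prefix of length \<open>N\<close> the corner values of the block converge to those of the
  classical rule, which differ by at most \<open>(3/5)\<^sup>N\<close> times a constant; inside the block the maximum
  principle \<open>val_between\<close> takes over, whatever the later coefficients are.\<close>

lemma val_trunc_tendsto: "(\<lambda>n. val (trunc x n) a) \<longlonglongrightarrow> bdry_val a x"
proof (rule LIMSEQ_I)
  fix \<epsilon> :: real assume \<epsilon>: "0 < \<epsilon>"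
  from spread_exists[of a] obtain D where D: "0 < D \<and> (\<forall>i j. \<bar>a i - a j\<bar> \<le> D)" ..
  have close: "\<bar>bdry_val a x - extend (trunc x n) a i\<bar> \<le> (3/5) ^ n * D" for n i
    by (rule bdry_val_close) (use D in blast)
  have "(\<lambda>n. (3/5) ^ n * D) \<longlonglongrightarrow> 0 * D" by (intro tendsto_mult LIMSEQ_power_zero) auto
  hence "\<forall>\<^sub>F n in sequentially. (3/5) ^ n * D < \<epsilon>/3" using \<epsilon> by (intro order_tendstoD) auto
  then obtain N where N: "(3/5) ^ N * D < \<epsilon>/3" by (auto simp: eventually_sequentially)
  obtain B where B: "\<And>i. (\<lambda>k. B k i) \<longlonglongrightarrow> extend (trunc x N) a i"
      "\<And>v. v \<noteq> [] \<Longrightarrow> val (trunc x N @ v) a = val v (B (length v))"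
    using val_prefix[of "\<lambda>_. a" a "trunc x N"] by auto
  have "\<forall>\<^sub>F k in sequentially. \<bar>B k i - extend (trunc x N) a i\<bar> < \<epsilon>/3" for i
    using tendstoD[OF B(1), of "\<epsilon>/3" i] \<epsilon> by (simp add: dist_real_def)
  hence "\<forall>\<^sub>F k in sequentially. \<forall>i. \<bar>B k i - extend (trunc x N) a i\<bar> < \<epsilon>/3"
    by (simp add: all_letter eventually_conj_iff)
  then obtain M where M: "\<And>k i. k \<ge> M \<Longrightarrow> \<bar>B k i - extend (trunc x N) a i\<bar> < \<epsilon>/3"
    by (auto simp: eventually_sequentially)
  show "\<exists>no. \<forall>n\<ge>no. norm (val (trunc x n) a - bdry_val a x) < \<epsilon>"
  proof (intro exI allI impI)
    fix n assume n: "Suc (N + M) \<le> n"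
    define k where "k = n - N"
    have k: "M \<le> k" "0 < k" "n = N + k" using n by (auto simp: k_def)
    let ?v = "trunc (\<lambda>m. x (N + m)) k"
    have "?v \<noteq> []" using k by (metis length_trunc list.size(3) less_irrefl)
    hence "val (trunc x n) a = val ?v (B k)" using B(2)[of ?v] k by (simp add: trunc_add)
    moreover have "bdry_val a x - 2/3 * \<epsilon> \<le> B k i \<and> B k i \<le> bdry_val a x + 2/3 * \<epsilon>" for i
      using M[OF k(1), of i] close[of N i] N by linarith
    from val_between[of "bdry_val a x - 2/3 * \<epsilon>" "B k" "bdry_val a x + 2/3 * \<epsilon>", OF this, of ?v]
    have "\<bar>val ?v (B k) - bdry_val a x\<bar> \<le> 2/3 * \<epsilon>" by (intro abs_leI) linarith+
    ultimately show "norm (val (trunc x n) a - bdry_val a x) < \<epsilon>" using \<epsilon> by simp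
  qed
qed

lemma val_harmonic:
  assumes d: "distinct [i, j, l]"
  shows "val (\<omega> @ i # replicate (Suc m) j) a = p * val (\<omega> @ j # replicate (Suc m) i) a
     + p * val (\<omega> @ i # replicate m j @ [i]) a + (1 - 2 * p) * val (\<omega> @ i # replicate m j @ [l]) a"
proof -
  obtain B where "\<And>v. v \<noteq> [] \<Longrightarrow> val (\<omega> @ v) a = val v (B (length v))"
    using val_prefix[of "\<lambda>_. a" a \<omega>] by auto
  thus ?thesis using val_harmonic_outer[OF d, of m "B (Suc (Suc m))"] by simp
qed

text \<open>The words \<open>j\<^bsup>n\<^esup> k\<close> take on average the value \<open>a j\<close> moved by the fraction \<open>mixing n\<close> towards the
  mean of the corner values (\<open>val_children\<close>).\<close>

definition "mixing n = (P n + Q n) / (1 - p)"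

lemma mixing_0 [simp]: "mixing 0 = 1" using p by (simp add: mixing_def PQ_0)

lemma mixing_pos: "0 < mixing n" and mixing_le: "mixing n \<le> (2 / 3) ^ n"
  using p P_pos[of n] Q_pos[of n] decay_le[of n] by (simp_all add: mixing_def field_simps add_pos_pos)

lemma mixing_le_1: "mixing n \<le> 1"
  using mixing_le[of n] power_le_one[of "2/3::real" n] by linarith

text \<open>In the sum of \<open>val_next_to_corner\<close> for \<open>i\<close> and for \<open>l\<close> as the preferred letter the weights \<open>P\<close> and
  \<open>Q\<close> only enter through \<open>P + Q\<close>.\<close>

lemma val_children:
  fixes m j a
  defines "\<mu> \<equiv> (\<Sum>k\<in>UNIV. a k) / 3"
  shows "(\<Sum>k\<in>UNIV. val (replicate m j @ [k]) a) / 3 = \<mu> + (1 - mixing m) * (a j - \<mu>)"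
proof -
  obtain i l where d: "distinct [i, j, l]" by (cases j) (auto intro: that[of L1 L3] that[of L2 L3] that[of L1 L2])
  let ?v = "\<lambda>k. val (replicate m j @ [k]) a"
  have j: "?v j = a j" using val_corner[of m j a] by (simp add: replicate_append_same)
  have "distinct [l, j, i]" using d by auto
  hence "(1 - p) * (?v i + ?v l) = 2 * (1 - p) * a j + (P m + Q m) * (a i + a l - 2 * a j)"
    using val_next_to_corner[OF d, of m a] val_next_to_corner[of l j i m a]
    by (simp add: algebra_simps)
  also have "P m + Q m = (1 - p) * mixing m" using p by (simp add: mixing_def)
  also have "2 * (1 - p) * a j + (1 - p) * mixing m * (a i + a l - 2 * a j) =
    (1 - p) * (2 * a j + mixing m * (a i + a l - 2 * a j))" by (simp add: algebra_simps)
  finally have "?v i + ?v l = 2 * a j + mixing m * (a i + a l - 2 * a j)" using p by simp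
  hence "?v i + ?v j + ?v l = 3 * a j + mixing m * (a i + a l - 2 * a j)" unfolding j by simp
  thus ?thesis unfolding \<mu>_def letter_sum_distinct[OF d] by (simp add: algebra_simps add_divide_distrib diff_divide_distrib)
qed

section \<open>The Martin kernel at the corners of the boundary\<close>

text \<open>The fluctuation of the corner values around their mean that survives from level \<open>n\<close> down to level
  \<open>m\<close>.\<close>

definition "damping m n = (\<Prod>k=m..<n. 1 - mixing k)"

text \<open>The corner values at level \<open>m\<close> of the probability of leaving level \<open>n\<close> through the corner \<open>c\<close>.\<close>

definition corner_vals :: "nat \<Rightarrow> nat \<Rightarrow> letter \<Rightarrow> letter \<Rightarrow> real" where
  "corner_vals m n c i = (1 - damping m n) / 3 + damping m n * of_bool (i = c)"

definition exit_val :: "nat \<Rightarrow> letter \<Rightarrow> word \<Rightarrow> real" where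
  "exit_val n c x = (if length x \<le> n then val x (corner_vals (length x) n c) else 0)"

lemma damping_bounds: "0 \<le> damping m n" "damping m n \<le> 1"
  using mixing_le_1 mixing_pos by (auto simp: damping_def less_imp_le intro!: prod_nonneg prod_le_1)

lemma damping_Suc_right: "m \<le> n \<Longrightarrow> damping m (Suc n) = damping m n * (1 - mixing n)"
  by (simp add: damping_def)

lemma damping_Suc_left: "m < n \<Longrightarrow> damping m n = (1 - mixing m) * damping (Suc m) n"
  by (simp add: damping_def prod.atLeast_Suc_lessThan)

lemma sum_corner_vals: "(\<Sum>i\<in>UNIV. corner_vals m n c i) = 1"
  by (cases c) (simp_all add: sum_letter corner_vals_def field_simps)

lemma corner_vals_bounds: "0 \<le> corner_vals m n c i \<and> corner_vals m n c i \<le> 1"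
  using damping_bounds[of m n] by (simp add: corner_vals_def field_simps)

text \<open>Inside a level this is the equation solved by \<open>val\<close>.  At a constant word of length \<open>k < n\<close> the
  chain moves up one level, and the factor \<open>1 - mixing k\<close> in \<open>damping\<close> makes the corner values of
  levels \<open>k\<close> and \<open>k + 1\<close> match.\<close>

lemma exit_val_harmonic:
  assumes u: "u \<noteq> replicate n c" and n: "1 \<le> n"
  shows "measure_pmf.expectation (step p u) (exit_val n c) = exit_val n c u"
proof (cases "\<exists>k i. u = replicate k i")
  case True
  then obtain k i where u': "u = replicate k i" by blast
  consider "k < n" | "k = n" "i \<noteq> c" | "k > n" using u u' by fastforce
  thus ?thesis
  proof cases
    case 1
    let ?a = "corner_vals (Suc k) n c"
    have "measure_pmf.expectation (step p u) (exit_val n c) =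
        (\<Sum>l\<in>UNIV. val (replicate k i @ [l]) ?a) / 3"
      unfolding u' expectation_step_const[OF p] using 1 by (simp add: exit_val_def)
    also have "\<dots> = 1 / 3 + (1 - mixing k) * (?a i - 1 / 3)"
      unfolding val_children sum_corner_vals ..
    also have "\<dots> = corner_vals k n c i"
      unfolding corner_vals_def damping_Suc_left[OF 1] by (simp add: field_simps)
    also have "\<dots> = exit_val n c u"
    proof (cases k)
      case 0
      thus ?thesis using 1 damping_Suc_left[OF 1]
        by (simp add: u' exit_val_def sum_corner_vals) (simp add: corner_vals_def)
    next
      case (Suc k')
      thus ?thesis using 1 val_corner[of k' i] by (simp add: u' exit_val_def del: replicate_Suc)
    qed
    finally show ?thesis .
  next
    case 2
    then obtain k' where "k = Suc k'" using n by (cases k) auto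
    thus ?thesis using 2 val_corner[of k' i]
      by (simp add: u' expectation_step_const[OF p] exit_val_def corner_vals_def damping_def del: replicate_Suc)
  next
    case 3
    thus ?thesis by (simp add: u' expectation_step_const[OF p] exit_val_def)
  qed
next
  case False
  hence "\<forall>n. u \<notin> const_words n" by (auto simp: const_words_def)
  then obtain \<omega> i j m where ij: "i \<noteq> j" and u': "u = \<omega> @ i # replicate (Suc m) j"
    by (rule decomp_exists)
  obtain l where d: "distinct [i, j, l]" using ij by (rule third_letter)
  hence l: "l \<notin> {i, j}" by auto
  show ?thesis
    unfolding u' expectation_step_decomp[OF p ij l]
    by (simp add: exit_val_def val_harmonic[OF d] del: replicate_Suc)
qed

lemma hit_corner:
  assumes n: "1 \<le> n"
  shows "hit_prob p x (replicate n c) = exit_val n c x"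
proof (rule hit_prob_eqI[OF p, where n = n])
  fix u
  show "0 \<le> exit_val n c u" "exit_val n c u \<le> 1"
    using val_between[of 0 "corner_vals (length u) n c" 1 u] corner_vals_bounds
    by (auto simp: exit_val_def)
  obtain k where "n = Suc k" using n by (cases n) auto
  thus "exit_val n c (replicate n c) = 1"
    using val_corner[of k c] by (simp add: exit_val_def corner_vals_def damping_def del: replicate_Suc)
next
  fix u
  show "exit_val n c u = 0" if "n < length u" using that by (simp add: exit_val_def)
  show "measure_pmf.expectation (step p u) (exit_val n c) = exit_val n c u" if "u \<noteq> replicate n c"
    using that n by (rule exit_val_harmonic)
qed

lemma martin_kernel_corner:
  assumes "1 \<le> n" "length x \<le> n"
  shows "martin_kernel p x (replicate n c) =
    1 + damping (length x) n * (3 * val x (\<lambda>i. of_bool (i = c)) - 1)"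
proof -
  have root: "exit_val n c [] = 1 / 3" by (simp add: exit_val_def sum_corner_vals)
  have x: "exit_val n c x = (1 - damping (length x) n) / 3 + damping (length x) n * val x (\<lambda>i. of_bool (i = c))"
    using assms by (simp add: exit_val_def corner_vals_def[abs_def] val_affine)
  show ?thesis
    by (simp add: martin_kernel_def hit_corner[OF assms(1)] root x algebra_simps diff_divide_distrib)
qed

text \<open>The product is at least \<open>1\<close> minus the sum of the \<open>mixing k\<close>, and \<open>mixing k \<le> (2/3)\<^sup>k\<close> makes that
  sum a piece of a geometric series.\<close>

lemma damping_ge: "m \<le> n \<Longrightarrow> 1 - 3 * (2 / 3) ^ m + 3 * (2 / 3) ^ n \<le> damping m n"
proof (induction n rule: dec_induct)
  case (step n)
  have "damping m n * mixing n \<le> 1 * mixing n"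
    using damping_bounds[of m n] mixing_pos[of n] by (intro mult_right_mono) auto
  thus ?case using step mixing_le[of n] by (simp add: damping_Suc_right algebra_simps)
qed (simp add: damping_def)

definition "damping_lim m = lim (damping m)"

lemma damping_tendsto: "damping m \<longlonglongrightarrow> damping_lim m"
proof -
  have "decseq (\<lambda>k. damping m (k + m))"
  proof (rule decseq_SucI)
    fix k show "damping m (Suc k + m) \<le> damping m (k + m)"
      using mult_left_mono[of "1 - mixing (k + m)" 1 "damping m (k + m)"] damping_bounds[of m "k + m"] mixing_pos[of "k + m"]
      by (simp add: damping_Suc_right)
  qed
  then obtain L where "(\<lambda>k. damping m (k + m)) \<longlonglongrightarrow> L"
    using decseq_convergent[of "\<lambda>k. damping m (k + m)" 0] damping_bounds by metis
  hence "damping m \<longlonglongrightarrow> L" by (rule LIMSEQ_offset)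
  thus ?thesis unfolding damping_lim_def by (simp add: limI)
qed

lemma damping_lim_tendsto: "damping_lim \<longlonglongrightarrow> 1"
proof -
  have "\<bar>damping_lim m - 1\<bar> \<le> (2 / 3) ^ m * 3" for m
  proof -
    have "1 - 3 * (2 / 3) ^ m \<le> damping m n" if "m \<le> n" for n
      using damping_ge[OF that] zero_le_power[of "2/3::real" n] by linarith
    hence "1 - 3 * (2 / 3) ^ m \<le> damping_lim m"
      by (intro tendsto_lowerbound[OF damping_tendsto]) (auto simp: eventually_sequentially)
    moreover have "damping_lim m \<le> 1"
      by (rule tendsto_upperbound[OF damping_tendsto]) (auto simp: damping_bounds)
    ultimately show ?thesis by (intro abs_leI) linarith+
  qed
  hence "(\<lambda>m. damping_lim m - 1) \<longlonglongrightarrow> 0" by (rule null_if_geometric_bound) auto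
  thus ?thesis by (rule LIM_zero_cancel)
qed

lemma basic_harmonic_eq:
  "basic_harmonic p c x = 1 + damping_lim (length x) * (3 * val x (\<lambda>i. of_bool (i = c)) - 1)"
proof -
  let ?f = "\<lambda>n. 1 + damping (length x) n * (3 * val x (\<lambda>i. of_bool (i = c)) - 1)"
  have "martin_kernel p x (trunc (\<lambda>_. c) n) = ?f n" if "Suc (length x) \<le> n" for n
    using martin_kernel_corner[of n x c] that by (simp add: trunc_def map_replicate_const)
  hence "\<forall>\<^sub>F n in sequentially. ?f n = martin_kernel p x (trunc (\<lambda>_. c) n)"
    unfolding eventually_sequentially by (intro exI[of _ "Suc (length x)"]) simp
  moreover have "?f \<longlonglongrightarrow> 1 + damping_lim (length x) * (3 * val x (\<lambda>i. of_bool (i = c)) - 1)"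
    by (intro tendsto_intros damping_tendsto)
  ultimately show ?thesis
    unfolding basic_harmonic_def martin_kernel_bdry_def by (intro limI) (rule Lim_transform_eventually)
qed

text \<open>Along an infinite word the remaining damping disappears, and with it the last dependence on \<open>p\<close>.\<close>

lemma basic_harmonic_bdry_eq: "basic_harmonic_bdry p c x = 3 * bdry_val (\<lambda>i. of_bool (i = c)) x"
proof -
  let ?\<delta> = "\<lambda>i. of_bool (i = c) :: real"
  have "(\<lambda>n. 1 + damping_lim n * (3 * val (trunc x n) ?\<delta> - 1)) \<longlonglongrightarrow> 1 + 1 * (3 * bdry_val ?\<delta> x - 1)"
    by (intro tendsto_intros damping_lim_tendsto val_trunc_tendsto)
  thus ?thesis unfolding basic_harmonic_bdry_def basic_harmonic_eq by (intro limI) simp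
qed

end

section \<open>Infinite words and boundary values\<close>

primrec prefixed :: "word \<Rightarrow> inf_word \<Rightarrow> inf_word" where
  "prefixed [] x = x"
| "prefixed (i # \<omega>) x = case_nat i (prefixed \<omega> x)"

lemma prefixed_append: "prefixed (\<omega> @ \<omega>') x = prefixed \<omega> (prefixed \<omega>' x)"
  by (induction \<omega>) simp_all

lemma case_nat_const [simp]: "case_nat i (\<lambda>_. i) = (\<lambda>_. i)"
  by (rule ext) (simp split: nat.split)

lemma case_nat_head_tail: "case_nat (x 0) (\<lambda>m. x (Suc m)) = x"
  by (rule ext) (simp split: nat.split)

lemma prefixed_replicate_const [simp]: "prefixed (replicate m i) (\<lambda>_. i) = (\<lambda>_. i)"
  by (induction m) simp_all

lemma trunc_case_nat: "trunc (case_nat i x) (Suc n) = i # trunc x n"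
  by (simp add: trunc_def upt_conv_Cons map_Suc_upt[symmetric] comp_def del: upt_Suc)

lemma trunc_prefixed: "trunc (prefixed \<omega> x) (length \<omega> + n) = \<omega> @ trunc x n"
  by (induction \<omega>) (simp_all add: trunc_case_nat)

lemma trunc_prefixed_length [simp]: "trunc (prefixed \<omega> x) (length \<omega>) = \<omega>"
  using trunc_prefixed[of \<omega> x 0] by (simp add: trunc_def)

lemma prefixed_nth_ge: "prefixed \<omega> x (length \<omega> + n) = x n"
  by (induction \<omega>) simp_all

lemma prefixed_trunc: "prefixed (trunc x n) (\<lambda>m. x (n + m)) = x"
proof (induction n arbitrary: x)
  case (Suc n)
  have "trunc x (Suc n) = x 0 # trunc (\<lambda>m. x (Suc m)) n"
    using trunc_case_nat[of "x 0" "\<lambda>m. x (Suc m)" n] by (simp only: case_nat_head_tail)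
  thus ?case using Suc.IH[of "\<lambda>m. x (Suc m)"] by (simp add: case_nat_head_tail)
qed (simp add: trunc_def)

lemma prefixed_inject:
  assumes "prefixed \<omega> x = prefixed \<omega>' y" "length \<omega> = length \<omega>'"
  shows "\<omega> = \<omega>' \<and> x = y"
proof
  show "\<omega> = \<omega>'" using assms by (metis trunc_prefixed_length)
  thus "x = y" using assms by (metis prefixed_nth_ge ext)
qed

text \<open>The position of the last change of letter is the length of the prefix.\<close>

lemma prefixed_last_change_unique:
  assumes eq: "prefixed \<sigma> (case_nat i (\<lambda>_. j)) = prefixed \<sigma>' (case_nat i' (\<lambda>_. j'))"
    and "i \<noteq> j" "i' \<noteq> j'"
  shows "\<sigma> = \<sigma>' \<and> i = i' \<and> j = j'"
proof -
  have after: "prefixed \<omega> (case_nat a (\<lambda>_. b)) n = b" if "length \<omega> < n" for \<omega> a b n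
    using prefixed_nth_ge[of \<omega> "case_nat a (\<lambda>_. b)" "n - length \<omega>"] that by (simp split: nat.split)
  have at: "prefixed \<omega> (case_nat a (\<lambda>_. b)) (length \<omega>) = a" for \<omega> a b
    using prefixed_nth_ge[of \<omega> "case_nat a (\<lambda>_. b)" 0] by simp
  let ?n = "Suc (max (length \<sigma>) (length \<sigma>'))"
  have j: "j = j'" using eq after[of \<sigma> ?n i j] after[of \<sigma>' ?n i' j'] by simp
  have "length \<sigma> = length \<sigma>'"
    using eq j assms(2,3) after[of \<sigma> "length \<sigma>'" i j] after[of \<sigma>' "length \<sigma>" i' j'] at[of \<sigma> i j] at[of \<sigma>' i' j']
    by (metis linorder_neqE_nat)
  from prefixed_inject[OF eq this] show ?thesis using j by (metis nat.case(1))
qed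

lemma bdry_val_prefixed: "bdry_val a (prefixed \<omega> x) = bdry_val (extend \<omega> a) x"
proof (rule bdry_val_eqI)
  have "(\<lambda>n. extend (trunc (prefixed \<omega> x) (n + length \<omega>)) a L1) \<longlonglongrightarrow> bdry_val (extend \<omega> a) x"
    using extend_tendsto[of x "extend \<omega> a" L1] by (simp add: add.commute[of _ "length \<omega>"] trunc_prefixed extend_append)
  thus "(\<lambda>n. extend (trunc (prefixed \<omega> x) n) a L1) \<longlonglongrightarrow> bdry_val (extend \<omega> a) x"
    by (rule LIMSEQ_offset)
qed

lemma extend_replicate_same [simp]: "extend (replicate n i) a i = a i"
  by (induction n arbitrary: a) simp_all

lemma bdry_val_const [simp]: "bdry_val a (\<lambda>_. i) = a i"
  by (rule bdry_val_eqI[of _ _ "\<lambda>_. i"]) (simp add: trunc_def map_replicate_const)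

lemma extend_sum: "extend \<omega> (\<lambda>k. \<Sum>c\<in>UNIV. t c * A c k) i = (\<Sum>c\<in>UNIV. t c * extend \<omega> (A c) i)"
  for A :: "letter \<Rightarrow> letter \<Rightarrow> real"
proof (induction \<omega> arbitrary: A)
  case (Cons j \<omega>)
  have "refine (2/5) (1/5) j (\<lambda>k. \<Sum>c\<in>UNIV. t c * A c k) = (\<lambda>k. \<Sum>c\<in>UNIV. t c * refine (2/5) (1/5) j (A c) k)"
    by (rule ext) (simp add: refine_def sum_letter field_simps)
  thus ?case by (simp add: Cons.IH)
qed simp

lemma bdry_val_sum: "bdry_val (\<lambda>k. \<Sum>c\<in>UNIV. t c * A c k) x = (\<Sum>c\<in>UNIV. t c * bdry_val (A c) x)"
  for A :: "letter \<Rightarrow> letter \<Rightarrow> real"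
  by (rule bdry_val_eqI[of _ _ "\<lambda>_. L1"]) (unfold extend_sum, intro tendsto_intros extend_tendsto)

lemma bdry_val_basis: "bdry_val a x = (\<Sum>c\<in>UNIV. a c * bdry_val (\<lambda>k. of_bool (k = c)) x)"
proof -
  have e: "(\<lambda>k. \<Sum>c\<in>UNIV. a c * of_bool (k = c)) = a"
  proof
    fix k show "(\<Sum>c\<in>UNIV. a c * of_bool (k = c)) = a k"
      by (cases k) (simp_all add: sum_letter)
  qed
  show ?thesis using bdry_val_sum[of a "\<lambda>c k. of_bool (k = c)" x] unfolding e .
qed

section \<open>The gasket as the image of the infinite words\<close>

lemma contr_word_Nil [simp]: "contr_word [] z = z"
  and contr_word_Cons [simp]: "contr_word (i # \<omega>) z = contr i (contr_word \<omega> z)"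
  and contr_word_append: "contr_word (\<omega> @ \<omega>') z = contr_word \<omega> (contr_word \<omega>' z)"
  by (simp_all add: contr_word_def)

lemma contr_diff: "contr i z - contr i w = (1/2) *\<^sub>R (z - w)"
  by (simp add: contr_def scaleR_add_right scaleR_diff_right)

lemma contr_word_diff: "contr_word \<omega> z - contr_word \<omega> w = (1/2) ^ length \<omega> *\<^sub>R (z - w)"
  by (induction \<omega>) (simp_all add: contr_diff)

lemma inj_contr_word: "contr_word \<omega> z = contr_word \<omega> w \<longleftrightarrow> z = w"
  using contr_word_diff[of \<omega> z w] by auto

lemma contr_corner [simp]: "contr i (corner i) = corner i"
  by (simp add: contr_def scaleR_2[symmetric])

lemma contr_corner_commute: "contr i (corner j) = contr j (corner i)"
  by (simp add: contr_def add.commute)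

lemma contr_word_replicate_corner [simp]: "contr_word (replicate n i) (corner i) = corner i"
  by (induction n) simp_all

lemma continuous_contr_word: "continuous_on S (contr_word \<omega>)"
proof (induction \<omega>)
  case (Cons i \<omega>)
  thus ?case unfolding contr_word_Cons contr_def by (intro continuous_intros)
qed (simp add: continuous_on_id)

lemma norm_corner_le: "norm (corner i) \<le> 1"
  by (cases i) (simp_all add: norm_vec_def L2_set_def UNIV_2 power_divide)

lemma norm_contr_word_le: "norm z \<le> 1 \<Longrightarrow> norm (contr_word \<omega> z) \<le> 1"
proof (induction \<omega>)
  case (Cons i \<omega>)
  have "norm (contr_word \<omega> z + corner i) \<le> 1 + 1"
    using Cons norm_corner_le by (intro norm_triangle_mono) auto
  thus ?case by (simp add: contr_def)
qed simp

lemma proj_tendsto_0: "(\<lambda>n. contr_word (trunc x n) 0) \<longlonglongrightarrow> proj x"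
proof -
  let ?z = "\<lambda>n. contr_word (trunc x n) 0"
  have *: "dist (?z (n + k)) (?z n) \<le> (1/2) ^ n" for n k
  proof -
    let ?w = "contr_word (trunc (\<lambda>m. x (n + m)) k) 0"
    have "?z (n + k) - ?z n = (1/2) ^ n *\<^sub>R (?w - 0)"
      by (simp add: trunc_add contr_word_append contr_word_diff del: diff_0_right)
    thus ?thesis using norm_contr_word_le[of 0 "trunc (\<lambda>m. x (n + m)) k"]
      by (simp add: dist_norm mult_left_le)
  qed
  have "Cauchy ?z"
  proof (rule metric_CauchyI)
    fix e :: real assume e: "0 < e"
    then obtain N where N: "(1/2) ^ N < e / 2" using real_arch_pow_inv[of "e/2" "1/2"] by auto
    have "dist (?z m) (?z N) < e / 2" if "N \<le> m" for m
      using *[of N "m - N"] N that by simp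
    thus "\<exists>M. \<forall>m\<ge>M. \<forall>n\<ge>M. dist (?z m) (?z n) < e"
      by (intro exI[of _ N] allI impI) (metis dist_triangle_half_l dist_commute)
  qed
  hence "convergent ?z" by (rule Cauchy_convergent)
  thus ?thesis unfolding proj_def by (simp add: convergent_LIMSEQ_iff)
qed

lemma proj_tendsto:
  assumes "\<And>n. norm (z n) \<le> B"
  shows "(\<lambda>n. contr_word (trunc x n) (z n)) \<longlonglongrightarrow> proj x"
proof -
  have B: "0 \<le> B" using assms[of 0] norm_ge_zero[of "z 0"] by linarith
  have "(\<lambda>n. contr_word (trunc x n) (z n) - contr_word (trunc x n) 0) \<longlonglongrightarrow> 0"
  proof (rule Lim_null_comparison)
    show "\<forall>\<^sub>F n in sequentially. norm (contr_word (trunc x n) (z n) - contr_word (trunc x n) 0) \<le> (1/2) ^ n * B"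
      unfolding contr_word_diff using assms by (simp add: mult_left_mono)
    have "(\<lambda>n. (1/2) ^ n * B) \<longlonglongrightarrow> 0 * B" by (intro tendsto_mult LIMSEQ_power_zero) auto
    thus "(\<lambda>n. (1/2) ^ n * B) \<longlonglongrightarrow> 0" by simp
  qed
  from tendsto_add[OF this proj_tendsto_0[of x]] show ?thesis by simp
qed

lemma proj_prefixed: "proj (prefixed \<omega> x) = contr_word \<omega> (proj x)"
proof -
  have t: "trunc (prefixed \<omega> x) (n + length \<omega>) = \<omega> @ trunc x n" for n
    using trunc_prefixed[of \<omega> x n] by (simp only: add.commute)
  have "isCont (contr_word \<omega>) (proj x)"
    using continuous_contr_word[of UNIV \<omega>] by (simp add: continuous_on_eq_continuous_at)
  from isCont_tendsto_compose[OF this proj_tendsto_0]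
  have "(\<lambda>n. contr_word (trunc (prefixed \<omega> x) (n + length \<omega>)) 0) \<longlonglongrightarrow> contr_word \<omega> (proj x)"
    unfolding t contr_word_append .
  hence "(\<lambda>n. contr_word (trunc (prefixed \<omega> x) n) 0) \<longlonglongrightarrow> contr_word \<omega> (proj x)"
    by (rule LIMSEQ_offset)
  thus ?thesis by (rule LIMSEQ_unique[OF proj_tendsto_0])
qed

lemma proj_case_nat: "proj (case_nat i x) = contr i (proj x)"
  using proj_prefixed[of "[i]" x] by simp

lemma proj_const [simp]: "proj (\<lambda>_. i) = corner i"
proof (rule LIMSEQ_unique[OF proj_tendsto[of "\<lambda>_. corner i" 1 "\<lambda>_. i"]])
  show "(\<lambda>n. contr_word (trunc (\<lambda>_. i) n) (corner i)) \<longlonglongrightarrow> corner i"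
    by (simp add: trunc_def map_replicate_const)
qed (rule norm_corner_le)

lemma range_proj_self_similar: "range proj = (\<Union>i. contr i ` range proj)"
proof safe
  fix x
  have "proj x = contr (x 0) (proj (\<lambda>m. x (Suc m)))"
    using proj_case_nat[of "x 0" "\<lambda>m. x (Suc m)"] by (simp only: case_nat_head_tail)
  thus "proj x \<in> (\<Union>i. contr i ` range proj)" by blast
next
  fix i x show "contr i (proj x) \<in> range proj" using proj_case_nat[of i x] by (metis rangeI)
qed

text \<open>Unfolding self-similarity from a point of \<open>A\<close> produces an infinite word whose images of \<open>A\<close>
  shrink to that point; conversely the images of one point of \<open>A\<close> stay in \<open>A\<close> and converge to any
  prescribed \<open>proj x\<close>.\<close>

lemma self_similar_compact_eq:
  assumes A: "compact A" "A \<noteq> {}" "A = (\<Union>i. contr i ` A)"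
  shows "A = range proj"
proof
  from A(1) obtain B where B: "\<And>z. z \<in> A \<Longrightarrow> norm z \<le> B"
    using compact_imp_bounded bounded_iff by metis
  show "A \<subseteq> range proj"
  proof
    fix z assume z: "z \<in> A"
    have "\<forall>w. \<exists>i v. w \<in> A \<longrightarrow> v \<in> A \<and> w = contr i v" using A(3) by blast
    then obtain f g where fg: "\<And>w. w \<in> A \<Longrightarrow> g w \<in> A \<and> w = contr (f w) (g w)" by metis
    define y where "y n = (g ^^ n) z" for n
    define x where "x n = f (y n)" for n
    have yA: "y n \<in> A" for n by (induction n) (use z fg in \<open>auto simp: y_def\<close>)
    have "contr_word (trunc x n) (y n) = z" for n
    proof (induction n)
      case (Suc n)
      have "y n = contr (x n) (y (Suc n))" using fg[OF yA[of n]] by (simp add: x_def y_def)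
      thus ?case using Suc by (simp add: trunc_Suc contr_word_append)
    qed (simp add: y_def trunc_def)
    hence "proj x = z"
      using proj_tendsto[of y B x] B yA LIMSEQ_unique[OF _ tendsto_const[of z]] by simp
    thus "z \<in> range proj" by blast
  qed
  show "range proj \<subseteq> A"
  proof safe
    fix x
    obtain z where z: "z \<in> A" using A(2) by blast
    have "contr_word \<omega> z \<in> A" for \<omega>
      by (induction \<omega>) (use z A(3) in auto)
    thus "proj x \<in> A"
      using closed_sequentially[OF compact_imp_closed[OF A(1)], of "\<lambda>n. contr_word (trunc x n) z" "proj x"]
        proj_tendsto[of "\<lambda>_. z" "norm z" x] by simp
  qed
qed

lemma closure_contr: "closure (contr i ` S) = contr i ` closure S"
proof -
  have "contr i ` S = (+) ((1/2) *\<^sub>R corner i) ` ((*\<^sub>R) (1/2) ` S)" for S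
    by (simp add: image_image contr_def scaleR_add_right add.commute)
  thus ?thesis by (simp add: closure_translation closure_scaleR)
qed

text \<open>The closure of \<open>range proj\<close> is again self-similar, and it is compact, so by uniqueness it is
  \<open>range proj\<close> itself.  This avoids a topology on the infinite words.\<close>

lemma compact_range_proj: "compact (range proj)"
proof -
  have "norm (proj x) \<le> 1" for x
    using norm_contr_word_le[of 0] by (intro tendsto_upperbound[OF tendsto_norm[OF proj_tendsto_0]]) auto
  hence "bounded (range proj)" by (auto simp: bounded_iff)
  hence c: "compact (closure (range proj))" by (simp add: compact_eq_bounded_closed bounded_closure)
  have "closure (range proj) = closure (\<Union>i. contr i ` range proj)"
    by (simp only: range_proj_self_similar[symmetric])
  also have "\<dots> = (\<Union>i. closure (contr i ` range proj))"
    unfolding UNIV_letter by simp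
  finally have "closure (range proj) = (\<Union>i. contr i ` closure (range proj))"
    by (simp only: closure_contr)
  from self_similar_compact_eq[OF c _ this] c show ?thesis by auto
qed

lemma gasket_eq: "gasket = range proj"
  unfolding gasket_def
proof (rule the_equality)
  show "compact (range proj) \<and> range proj \<noteq> {} \<and> range proj = (\<Union>i. contr i ` range proj)"
    by (intro conjI compact_range_proj range_proj_self_similar) simp
next
  fix A assume "compact A \<and> A \<noteq> {} \<and> A = (\<Union>i. contr i ` A)"
  thus "A = range proj" by (elim conjE) (rule self_similar_compact_eq)
qed

text \<open>Barycentric coordinates with respect to the three corners.\<close>

primrec bary :: "letter \<Rightarrow> real ^ 2 \<Rightarrow> real" where
  "bary L1 z = 2 * z $ 2 / sqrt 3"
| "bary L2 z = 1 - z $ 1 - z $ 2 / sqrt 3"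
| "bary L3 z = z $ 1 - z $ 2 / sqrt 3"

lemma bary_corner [simp]: "bary i (corner j) = of_bool (i = j)"
  by (cases i; cases j) simp_all

lemma bary_contr: "bary i (contr j z) = (bary i z + of_bool (i = j)) / 2"
proof -
  have "bary i ((1/2) *\<^sub>R (z + w)) = (bary i z + bary i w) / 2" for w
    by (cases i) (simp_all add: add_divide_distrib diff_divide_distrib)
  thus ?thesis by (simp add: contr_def)
qed

lemma bary_sum: "(\<Sum>i\<in>UNIV. bary i z) = 1"
  by (simp add: sum_letter)

declare bary.simps [simp del] corner.simps [simp del]

lemma bary_proj_nonneg: "0 \<le> bary i (proj x)"
proof (rule tendsto_lowerbound)
  have "(\<lambda>n. contr_word (trunc x n) (corner L1)) \<longlonglongrightarrow> proj x"
    by (rule proj_tendsto) (rule norm_corner_le)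
  hence "(\<lambda>n. contr_word (trunc x n) (corner L1) $ k) \<longlonglongrightarrow> proj x $ k" for k
    by (rule tendsto_vec_nth)
  thus "(\<lambda>n. bary i (contr_word (trunc x n) (corner L1))) \<longlonglongrightarrow> bary i (proj x)"
    by (cases i) (auto simp: bary.simps intro!: tendsto_diff tendsto_divide tendsto_mult tendsto_const)
  have "0 \<le> bary i (contr_word \<omega> (corner L1))" for \<omega>
    by (induction \<omega>) (simp_all add: bary_contr)
  thus "\<forall>\<^sub>F n in sequentially. 0 \<le> bary i (contr_word (trunc x n) (corner L1))" by simp
qed simp

lemma bary_proj_le_1: "bary i (proj x) \<le> 1"
  using bary_sum[of "proj x"] bary_proj_nonneg[of L1 x] bary_proj_nonneg[of L2 x] bary_proj_nonneg[of L3 x]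
  by (cases i) (simp_all add: sum_letter)

lemma bary_proj_eq_1:
  assumes "bary j (proj x) = 1" shows "x = (\<lambda>_. j)"
proof
  have *: "x 0 = j \<and> bary j (proj (\<lambda>m. x (Suc m))) = 1" if "bary j (proj x) = 1" for x
  proof -
    have "bary j (proj x) = (bary j (proj (\<lambda>m. x (Suc m))) + of_bool (j = x 0)) / 2"
      using bary_contr[of j "x 0" "proj (\<lambda>m. x (Suc m))"]
      by (simp only: proj_case_nat[symmetric] case_nat_head_tail)
    thus ?thesis using that bary_proj_le_1[of j "\<lambda>m. x (Suc m)"] by (cases "x 0 = j") auto
  qed
  show "x n = j" for n using assms
  proof (induction n arbitrary: x)
    case (Suc n) thus ?case using *[OF Suc.prems] Suc.IH[of "\<lambda>m. x (Suc m)"] by simp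
  qed (use * in blast)
qed

text \<open>Two first-level triangles meet only in the common midpoint: there the coordinate \<open>j\<close> of
  \<open>proj x\<close> and the coordinate \<open>i\<close> of \<open>proj y\<close> must be \<open>1\<close>, and a corner has only one address.\<close>

lemma contr_proj_eq:
  assumes ij: "i \<noteq> j" and eq: "contr i (proj x) = contr j (proj y)"
  shows "x = (\<lambda>_. j) \<and> y = (\<lambda>_. i)"
proof -
  have "bary i (proj x) + 1 = bary i (proj y)" "bary j (proj x) = bary j (proj y) + 1"
    using arg_cong[OF eq, of "bary i"] arg_cong[OF eq, of "bary j"] ij by (simp_all add: bary_contr)
  hence "bary j (proj x) = 1" "bary i (proj y) = 1"
    using bary_proj_nonneg[of i x] bary_proj_nonneg[of j y] bary_proj_le_1[of i y] bary_proj_le_1[of j x] by linarith+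
  thus ?thesis using bary_proj_eq_1 by blast
qed

text \<open>Split both words at their first difference and cancel the common prefix.\<close>

lemma proj_eqE:
  assumes eq: "proj x = proj y" and ne: "x \<noteq> y"
  obtains \<omega> i j where "i \<noteq> j" "x = prefixed \<omega> (case_nat i (\<lambda>_. j))" "y = prefixed \<omega> (case_nat j (\<lambda>_. i))"
proof -
  define n where "n = (LEAST n. x n \<noteq> y n)"
  obtain k where "x k \<noteq> y k" using ne by (auto simp: fun_eq_iff)
  hence n: "x n \<noteq> y n" unfolding n_def by (rule LeastI)
  have "x m = y m" if "m < n" for m
    using not_less_Least[of m "\<lambda>n. x n \<noteq> y n"] that unfolding n_def by blast
  hence t: "trunc x n = trunc y n" unfolding trunc_def by (intro map_cong) auto
  define tail where "tail z = (\<lambda>m. z (Suc (n + m)))" for z :: inf_word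
  have split: "prefixed (trunc z n) (case_nat (z n) (tail z)) = z" for z
  proof -
    have "case_nat (z n) (tail z) = (\<lambda>m. z (n + m))"
      by (rule ext) (simp add: tail_def split: nat.split)
    thus ?thesis using prefixed_trunc[of z n] by simp
  qed
  have p: "proj z = contr_word (trunc z n) (contr (z n) (proj (tail z)))" for z
    using proj_prefixed[of "trunc z n" "case_nat (z n) (tail z)"] by (simp only: split proj_case_nat)
  have "contr_word (trunc x n) (contr (x n) (proj (tail x))) =
      contr_word (trunc x n) (contr (y n) (proj (tail y)))"
    by (subst p[of x, symmetric], subst t, subst p[of y, symmetric], rule eq)
  hence "contr (x n) (proj (tail x)) = contr (y n) (proj (tail y))" by (simp only: inj_contr_word)
  from contr_proj_eq[OF n this] have tail: "tail x = (\<lambda>_. y n)" "tail y = (\<lambda>_. x n)" by auto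
  show ?thesis
  proof (rule that[OF n])
    show "x = prefixed (trunc x n) (case_nat (x n) (\<lambda>_. y n))"
      using split[of x] unfolding tail by (rule sym)
    show "y = prefixed (trunc x n) (case_nat (y n) (\<lambda>_. x n))"
      using split[of y] unfolding tail t by (rule sym)
  qed
qed

section \<open>Canonical harmonic functions\<close>

lemma vertex_address: "contr_word \<omega> (corner i) = proj (prefixed \<omega> (\<lambda>_. i))"
  by (simp add: proj_prefixed)

lemma inner_vertex_not_corner:
  assumes "k \<noteq> i" shows "proj (prefixed \<tau> (case_nat k (\<lambda>_. i))) \<notin> range corner"
proof
  assume "proj (prefixed \<tau> (case_nat k (\<lambda>_. i))) \<in> range corner"
  then obtain j where j: "proj (prefixed \<tau> (case_nat k (\<lambda>_. i))) = proj (\<lambda>_. j)" by auto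
  hence "bary j (proj (prefixed \<tau> (case_nat k (\<lambda>_. i)))) = 1" by simp
  hence "prefixed \<tau> (case_nat k (\<lambda>_. i)) = (\<lambda>_. j)" by (rule bary_proj_eq_1)
  hence "prefixed \<tau> (case_nat k (\<lambda>_. i)) (length \<tau> + n) = j" for n by simp
  from this[of 0] this[of 1] have "k = j" "i = j" by (simp_all only: prefixed_nth_ge) simp_all
  thus False using assms by simp
qed

lemma vertex_not_corner_decomp:
  assumes "contr_word \<omega> (corner i) \<notin> range corner"
  obtains \<tau> k m where "k \<noteq> i" "\<omega> = \<tau> @ k # replicate m i"
proof -
  have "\<exists>k\<in>set \<omega>. k \<noteq> i"
  proof (rule ccontr)
    assume "\<not> (\<exists>k\<in>set \<omega>. k \<noteq> i)"
    hence "\<omega> = replicate (length \<omega>) i" by (intro replicate_eqI) auto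
    hence "contr_word \<omega> (corner i) = corner i" by (metis contr_word_replicate_corner)
    thus False using assms by auto
  qed
  then obtain \<tau> k \<rho> where d: "\<omega> = \<tau> @ k # \<rho>" "k \<noteq> i" "\<forall>z\<in>set \<rho>. \<not> z \<noteq> i"
    using split_list_last_prop[of \<omega> "\<lambda>k. k \<noteq> i"] by blast
  hence "\<rho> = replicate (length \<rho>) i" by (intro replicate_eqI) auto
  thus ?thesis using that d by metis
qed

lemma prefixed_block: "prefixed (\<tau> @ k # replicate m i) (\<lambda>_. i) = prefixed \<tau> (case_nat k (\<lambda>_. i))"
  by (simp add: prefixed_append)

lemma two_addresses:
  "contr_word (\<tau> @ k # replicate m i) (corner i) = contr_word (\<tau> @ i # replicate m k) (corner k)"
  by (simp add: contr_word_append contr_corner_commute)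

lemma vertex_words:
  assumes ki: "k \<noteq> i" and len: "length \<omega> = length (\<tau> @ k # replicate m i)"
    and eq: "contr_word (\<tau> @ k # replicate m i) (corner i) = contr_word \<omega> (corner a)"
  shows "\<omega> = \<tau> @ k # replicate m i \<and> a = i \<or> \<omega> = \<tau> @ i # replicate m k \<and> a = k"
proof -
  let ?x = "prefixed (\<tau> @ k # replicate m i) (\<lambda>_. i)" and ?y = "prefixed \<omega> (\<lambda>_. a)"
  have p: "proj ?x = proj ?y" using eq unfolding vertex_address .
  show ?thesis
  proof (cases "?x = ?y")
    case True
    from prefixed_inject[OF this len[symmetric]] show ?thesis by (metis fun_cong)
  next
    case False
    from p False obtain \<sigma> c d where cd: "c \<noteq> d" "?x = prefixed \<sigma> (case_nat c (\<lambda>_. d))"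
        "?y = prefixed \<sigma> (case_nat d (\<lambda>_. c))"
      by (rule proj_eqE)
    from cd(2) have "\<tau> = \<sigma> \<and> k = c \<and> i = d"
      unfolding prefixed_block by (rule prefixed_last_change_unique) (use ki cd in auto)
    hence "?y = prefixed (\<tau> @ i # replicate m k) (\<lambda>_. k)" using cd(3) prefixed_block[of \<tau> i m k] by simp
    moreover have "length \<omega> = length (\<tau> @ i # replicate m k)" using len by simp
    ultimately have "\<omega> = \<tau> @ i # replicate m k \<and> (\<lambda>_. a) = (\<lambda>_::nat. k)" by (rule prefixed_inject)
    thus ?thesis by (metis fun_cong)
  qed
qed

text \<open>An inner vertex of level \<open>n\<close> has exactly two addresses of length \<open>n\<close>, and each of the two triangles
  contributes its other two corners.\<close>

lemma sum_neighbours: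
  fixes k i l :: letter and \<tau> :: word and m n :: nat
  assumes d: "distinct [k, i, l]" and n: "n = length \<tau> + Suc m"
  defines "\<omega> \<equiv> \<tau> @ k # replicate m i" and "\<omega>' \<equiv> \<tau> @ i # replicate m k"
  shows "(\<Sum>y\<in>neighbours n (contr_word \<omega> (corner i)). h y) =
    h (contr_word \<omega> (corner k)) + h (contr_word \<omega> (corner l)) +
    h (contr_word \<omega>' (corner i)) + h (contr_word \<omega>' (corner l))"
proof -
  have ki: "k \<noteq> i" using d by simp
  have inj: "corner a = corner b \<longleftrightarrow> a = b" for a b
    by (metis bary_corner of_bool_eq_iff)
  have cross: "contr_word \<omega> (corner b) \<noteq> contr_word \<omega>' (corner c)" if "b \<noteq> i" for b c
  proof
    assume "contr_word \<omega> (corner b) = contr_word \<omega>' (corner c)"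
    hence "contr k (proj (prefixed (replicate m i) (\<lambda>_. b))) = contr i (proj (prefixed (replicate m k) (\<lambda>_. c)))"
      unfolding \<omega>_def \<omega>'_def contr_word_append inj_contr_word by (simp add: proj_prefixed)
    from contr_proj_eq[OF ki this] have "prefixed (replicate m i) (\<lambda>_. b) = (\<lambda>_. i)" by simp
    hence "prefixed (replicate m i) (\<lambda>_. b) (length (replicate m i) + 0) = i" by simp
    thus False using that by (simp only: prefixed_nth_ge)
  qed
  have len: "length \<omega> = n" "length \<omega>' = n" using n by (simp_all add: \<omega>_def \<omega>'_def)
  have other: "b \<in> {k, l}" if "b \<noteq> i" for b using that d by (cases b; cases i; cases k; cases l) auto
  have other': "b \<in> {i, l}" if "b \<noteq> k" for b using that d by (cases b; cases i; cases k; cases l) auto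
  have two: "contr_word \<omega> (corner i) = contr_word \<omega>' (corner k)"
    unfolding \<omega>_def \<omega>'_def by (rule two_addresses)
  have "neighbours n (contr_word \<omega> (corner i)) = {contr_word \<omega> (corner k), contr_word \<omega> (corner l),
      contr_word \<omega>' (corner i), contr_word \<omega>' (corner l)}" (is "?N = ?S")
  proof
    show "?N \<subseteq> ?S"
    proof
      fix y assume "y \<in> ?N"
      then obtain \<omega>1 a b where w: "length \<omega>1 = n" "a \<noteq> b" "contr_word \<omega> (corner i) = contr_word \<omega>1 (corner a)"
          "y = contr_word \<omega>1 (corner b)"
        unfolding neighbours_def mem_Collect_eq by (elim exE conjE) (rule that)
      have "length \<omega>1 = length (\<tau> @ k # replicate m i)" using w(1) n by simp
      from vertex_words[OF ki this w(3)[unfolded \<omega>_def]]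
      have "\<omega>1 = \<omega> \<and> a = i \<or> \<omega>1 = \<omega>' \<and> a = k" unfolding \<omega>_def \<omega>'_def .
      thus "y \<in> ?S" using w(2,4) other[of b] other'[of b] by auto
    qed
    have N: "contr_word v (corner b) \<in> neighbours n (contr_word v (corner a))"
      if "length v = n" "a \<noteq> b" for v a b
      unfolding neighbours_def mem_Collect_eq
      by (rule exI[of _ v], rule exI[of _ a], rule exI[of _ b]) (use that in simp)
    have "k \<noteq> i" "l \<noteq> i" "i \<noteq> k" "l \<noteq> k" using d by auto
    thus "?S \<subseteq> ?N"
      using N[OF len(1), of i k] N[OF len(1), of i l]
        N[OF len(2), of k i, folded two] N[OF len(2), of k l, folded two] by simp
  qed
  moreover have "k \<noteq> l" "i \<noteq> l" "k \<noteq> i" "l \<noteq> i" using d by auto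
  ultimately show ?thesis by (simp add: cross inj_contr_word inj add.assoc)
qed

lemma refine_canonical:
  assumes "distinct [i, j, l]" shows "refine (2/5) (1/5) j a i = (2 * a i + 2 * a j + a l) / 5"
  unfolding refine_other[OF assms] by (simp add: field_simps)

lemma refine_midpoint: "refine (2/5) (1/5) j a i = refine (2/5) (1/5) i a j"
proof (cases "i = j")
  case False
  then obtain l where "distinct [i, j, l]" by (rule third_letter)
  moreover from this have "distinct [j, i, l]" by auto
  ultimately show ?thesis by (simp only: refine_canonical) (simp add: add.commute)
qed simp

text \<open>The normal derivative at the corner \<open>i\<close>: this difference, renormalised by \<open>(5/3)\<^sup>m\<close>, is the same on
  all levels.\<close>

lemma extend_replicate_flux:
  assumes d: "distinct [i, k, l]"
  shows "extend (replicate m i) a k + extend (replicate m i) a l - 2 * a i = (3/5) ^ m * (a k + a l - 2 * a i)"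
proof (induction m arbitrary: a)
  case (Suc m)
  have "refine (2/5) (1/5) i a k + refine (2/5) (1/5) i a l - 2 * a i = 3/5 * (a k + a l - 2 * a i)"
  proof -
    have "distinct [k, i, l]" "distinct [l, i, k]" using d by auto
    thus ?thesis by (simp only: refine_canonical) (simp add: field_simps)
  qed
  thus ?case using Suc.IH[of "refine (2/5) (1/5) i a"] by simp
qed simp

text \<open>By \<open>extend_replicate_flux\<close> the claim reduces to the triangles in which the vertex is a midpoint
  of a side, and there it is a computation with the extension rule.\<close>

lemma extend_balance:
  fixes k i l :: letter and \<tau> :: word and m :: nat
  assumes d: "distinct [k, i, l]"
  defines "\<omega> \<equiv> \<tau> @ k # replicate m i" and "\<omega>' \<equiv> \<tau> @ i # replicate m k"
  shows "extend \<omega> a i = (extend \<omega> a k + extend \<omega> a l + extend \<omega>' a i + extend \<omega>' a l) / 4"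
proof -
  let ?c = "extend \<tau> a" and ?r = "refine (2/5) (1/5)"
  let ?K = "?r k ?c" and ?I = "?r i ?c"
  have e: "extend \<omega> a j = extend (replicate m i) ?K j" "extend \<omega>' a j = extend (replicate m k) ?I j" for j
    by (simp_all add: \<omega>_def \<omega>'_def extend_append)
  have "distinct [i, k, l]" using d by auto
  note f = extend_replicate_flux[OF this, of m ?K] extend_replicate_flux[OF d, of m ?I]
  have mid: "?I k = ?K i" by (rule refine_midpoint)
  have "?K i = (2 * ?c i + 2 * ?c k + ?c l) / 5" by (rule refine_canonical) (use d in auto)
  moreover have "?K l = (2 * ?c l + 2 * ?c k + ?c i) / 5" by (rule refine_canonical) (use d in auto)
  moreover have "?I l = (2 * ?c l + 2 * ?c i + ?c k) / 5" by (rule refine_canonical) (use d in auto)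
  ultimately have "(?K k + ?K l - 2 * ?K i) + (?I i + ?I l - 2 * ?I k) = 0" unfolding mid by simp
  hence "(3/5) ^ m * (?K k + ?K l - 2 * ?K i) + (3/5) ^ m * (?I i + ?I l - 2 * ?I k) = 0"
    by (simp only: distrib_left[symmetric] mult_zero_right)
  thus ?thesis using f mid unfolding e by simp
qed

lemma canonical_harmonic_midpoint:
  assumes h: "h \<in> canonical_harmonic" and d: "distinct [k, i, l]"
  shows "4 * h (contr_word (\<omega> @ [k]) (corner i)) =
    h (contr_word \<omega> (corner k)) + h (contr_word (\<omega> @ [k]) (corner l)) +
    h (contr_word \<omega> (corner i)) + h (contr_word (\<omega> @ [i]) (corner l))"
proof -
  let ?n = "length \<omega> + Suc 0" and ?x = "contr_word (\<omega> @ [k]) (corner i)"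
  have "?x \<in> vertices ?n" unfolding vertices_def by force
  moreover have "?x \<notin> range corner"
    using inner_vertex_not_corner[of k i \<omega>] d by (simp add: vertex_address prefixed_append)
  ultimately have "h ?x = (\<Sum>y\<in>neighbours ?n ?x. h y) / 4"
    using h unfolding canonical_harmonic_def by auto
  thus ?thesis using sum_neighbours[OF d, of ?n \<omega> 0 h] by (simp add: contr_word_append)
qed

text \<open>The three midpoint equations of a triangle form a linear system with a unique solution,
  the extension rule.\<close>

lemma canonical_harmonic_extend:
  assumes h: "h \<in> canonical_harmonic"
  shows "h (contr_word \<omega> (corner i)) = extend \<omega> (\<lambda>k. h (corner k)) i"
proof (induction \<omega> arbitrary: i rule: rev_induct)
  case (snoc k \<omega>)
  let ?c = "extend \<omega> (\<lambda>k. h (corner k))"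
  show ?case
  proof (cases "i = k")
    case True
    thus ?thesis using snoc[of k] by (simp add: contr_word_append extend_append)
  next
    case False
    then obtain l where d: "distinct [i, k, l]" by (rule third_letter)
    define b where "b k i = h (contr_word (\<omega> @ [k]) (corner i))" for k i
    have sym: "b k i = b i k" for k i by (simp add: b_def contr_word_append contr_corner_commute)
    have "4 * b k i = ?c k + b k l + ?c i + b i l" "4 * b k l = ?c k + b k i + ?c l + b l i"
      "4 * b i l = ?c i + b i k + ?c l + b l k"
      using d canonical_harmonic_midpoint[OF h, of _ _ _ \<omega>] unfolding b_def snoc by auto
    hence "b k i = (2 * ?c i + 2 * ?c k + ?c l) / 5"
      using sym[of l i] sym[of i k] sym[of l k] by simp
    also have "\<dots> = extend (\<omega> @ [k]) (\<lambda>k. h (corner k)) i"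
      using refine_canonical[OF d] by (simp add: extend_append)
    finally show ?thesis by (simp add: b_def)
  qed
qed simp

lemma canonical_harmonic_bdry_val:
  assumes h: "h \<in> canonical_harmonic"
  shows "h (proj x) = bdry_val (\<lambda>k. h (corner k)) x"
proof -
  have c: "continuous_on gasket h" using h by (simp add: canonical_harmonic_def)
  have t: "(\<lambda>n. contr_word (trunc x n) (corner L1)) \<longlonglongrightarrow> proj x"
    by (rule proj_tendsto) (rule norm_corner_le)
  have "(\<lambda>n. h (contr_word (trunc x n) (corner L1))) \<longlonglongrightarrow> h (proj x)"
    by (rule continuous_on_tendsto_compose[OF c t]) (simp_all add: gasket_eq vertex_address)
  thus ?thesis unfolding canonical_harmonic_extend[OF h] by (rule bdry_val_eqI[symmetric])
qed

text \<open>Given a point \<open>z\<close> of the gasket, the level-\<open>n\<close> triangles that miss \<open>z\<close> form a closed set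
  without \<open>z\<close>.  A point of the gasket near \<open>z\<close> therefore lies in a triangle together with \<open>z\<close>, and there the
  function oscillates by at most a multiple of \<open>(3/5)\<^sup>n\<close>.\<close>

lemma continuous_on_gasketI:
  assumes u: "\<And>x. u (proj x) = bdry_val a x"
  shows "continuous_on gasket u"
  unfolding continuous_on_iff
proof (intro ballI allI impI)
  fix z and \<epsilon> :: real assume z: "z \<in> gasket" and \<epsilon>: "0 < \<epsilon>"
  from spread_exists[of a] obtain D where D: "0 < D \<and> (\<forall>i j. \<bar>a i - a j\<bar> \<le> D)" ..
  have close: "\<bar>bdry_val a x - extend (trunc x n) a i\<bar> \<le> (3/5) ^ n * D" for x n i
    by (rule bdry_val_close) (use D in blast)
  obtain n where "(3/5) ^ n < \<epsilon> / (2 * D)" using real_arch_pow_inv[of "\<epsilon> / (2 * D)" "3/5"] D \<epsilon> by auto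
  hence n: "(3/5) ^ n * D < \<epsilon> / 2" using D by (simp add: field_simps)
  define F where "F = (\<Union>\<omega>\<in>{\<omega>. length \<omega> = n \<and> z \<notin> contr_word \<omega> ` gasket}. contr_word \<omega> ` gasket)"
  have "finite {\<omega> :: word. length \<omega> = n}"
    using finite_lists_length_eq[of "UNIV :: letter set" n] by simp
  hence "finite {\<omega>. length \<omega> = n \<and> z \<notin> contr_word \<omega> ` gasket}" by (rule rev_finite_subset) auto
  hence "closed F" unfolding F_def
    by (intro closed_UN ballI compact_imp_closed compact_continuous_image continuous_contr_word)
       (simp_all add: gasket_eq compact_range_proj)
  moreover have "z \<notin> F" by (auto simp: F_def)
  ultimately obtain \<delta> where \<delta>: "0 < \<delta>" "ball z \<delta> \<subseteq> - F"
    using open_contains_ball[of "- F"] by (auto simp: closed_def)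
  show "\<exists>\<delta>>0. \<forall>z'\<in>gasket. dist z' z < \<delta> \<longrightarrow> dist (u z') (u z) < \<epsilon>"
  proof (intro exI conjI ballI impI)
    fix z' assume z': "z' \<in> gasket" "dist z' z < \<delta>"
    then obtain y where y: "z' = proj y" by (auto simp: gasket_eq)
    let ?\<omega> = "trunc y n"
    have "proj y = contr_word ?\<omega> (proj (\<lambda>m. y (n + m)))"
      using proj_prefixed[of ?\<omega> "\<lambda>m. y (n + m)"] by (simp only: prefixed_trunc)
    hence "z' \<in> contr_word ?\<omega> ` gasket" by (simp add: y gasket_eq)
    moreover have "z' \<in> ball z \<delta>" using z'(2) by (simp add: dist_commute)
    hence "z' \<notin> F" using \<delta>(2) by blast
    ultimately have "z \<in> contr_word ?\<omega> ` gasket" 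
      unfolding F_def using length_trunc[of y n] by blast
    then obtain x where x: "z = proj (prefixed ?\<omega> x)" by (auto simp: gasket_eq proj_prefixed)
    have "trunc (prefixed ?\<omega> x) n = ?\<omega>" using trunc_prefixed_length[of ?\<omega> x] by simp
    hence "\<bar>u z - extend ?\<omega> a L1\<bar> \<le> (3/5) ^ n * D"
      using close[of "prefixed ?\<omega> x" n L1] by (simp add: x u)
    moreover have "\<bar>u z' - extend ?\<omega> a L1\<bar> \<le> (3/5) ^ n * D"
      using close[of y n L1] by (simp add: y u)
    ultimately show "dist (u z') (u z) < \<epsilon>" using n unfolding dist_real_def by linarith
  qed (fact \<delta>(1))
qed

text \<open>The mean value property holds already for the corner values, by \<open>extend_balance\<close>, since a vertex
  and its neighbours are corners of triangles of the same level.\<close>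

lemma canonical_harmonicI:
  assumes g: "u \<in> gasket_funs" and u: "\<And>x. u (proj x) = bdry_val a x"
  shows "u \<in> canonical_harmonic"
  unfolding canonical_harmonic_def
proof (intro CollectI conjI allI impI ballI)
  fix n x assume "x \<in> vertices n - range corner"
  then obtain \<omega> i where x: "x = contr_word \<omega> (corner i)" "length \<omega> = n" "x \<notin> range corner"
    by (auto simp: vertices_def)
  obtain \<tau> k m where d: "k \<noteq> i" "\<omega> = \<tau> @ k # replicate m i"
    using vertex_not_corner_decomp x by metis
  then obtain l where l: "distinct [k, i, l]" using third_letter by blast
  have e: "u (contr_word \<omega> (corner j)) = extend \<omega> a j" for \<omega> j
    unfolding vertex_address u bdry_val_prefixed by simp
  have "n = length \<tau> + Suc m" using x d by simp
  from sum_neighbours[OF l this, of u] extend_balance[OF l, of \<tau> m a]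
  show "u x = (\<Sum>y\<in>neighbours n x. u y) / 4"
    unfolding x(1) d(2) e by simp
qed (use g continuous_on_gasketI[OF u] in auto)

section \<open>Harmonic functions as extensions of corner values\<close>

text \<open>Two addresses of one point come from the two triangles that share a midpoint, and the extension
  rule is symmetric at midpoints (\<open>refine_midpoint\<close>).\<close>

lemma bdry_val_proj:
  assumes "proj x = proj y" shows "bdry_val a x = bdry_val a y"
proof (cases "x = y")
  case False
  from assms this obtain \<omega> i j where "x = prefixed \<omega> (case_nat i (\<lambda>_. j))" "y = prefixed \<omega> (case_nat j (\<lambda>_. i))"
    by (rule proj_eqE)
  moreover have "bdry_val b (case_nat i (\<lambda>_. j)) = refine (2/5) (1/5) i b j" for b i j
    using bdry_val_prefixed[of b "[i]" "\<lambda>_. j"] by simp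
  ultimately show ?thesis by (simp add: bdry_val_prefixed refine_midpoint)
qed simp

text \<open>By \<open>bdry_val_proj\<close> the choice of the address is immaterial.\<close>

definition gasket_extension :: "(letter \<Rightarrow> real) \<Rightarrow> real ^ 2 \<Rightarrow> real" where
  "gasket_extension a z = (if z \<in> gasket then bdry_val a (SOME x. proj x = z) else 0)"

lemma gasket_extension_proj: "gasket_extension a (proj x) = bdry_val a x"
proof -
  have "proj (SOME y. proj y = proj x) = proj x" by (rule someI[of _ x]) (rule refl)
  thus ?thesis by (auto simp: gasket_extension_def gasket_eq intro: bdry_val_proj)
qed

lemma gasket_extension_corner [simp]: "gasket_extension a (corner i) = a i"
  using gasket_extension_proj[of a "\<lambda>_. i"] by simp

lemma gasket_extension_in_gasket_funs: "gasket_extension a \<in> gasket_funs"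
  by (simp add: gasket_funs_def gasket_extension_def)

lemma canonical_harmonic_eq: "canonical_harmonic = range gasket_extension"
proof safe
  fix h assume h: "h \<in> canonical_harmonic"
  have "h = gasket_extension (\<lambda>k. h (corner k))"
  proof
    fix z show "h z = gasket_extension (\<lambda>k. h (corner k)) z"
    proof (cases "z \<in> gasket")
      case True
      thus ?thesis
        using canonical_harmonic_bdry_val[OF h] by (auto simp: gasket_eq gasket_extension_proj)
    next
      case False
      thus ?thesis using h by (simp add: canonical_harmonic_def gasket_funs_def gasket_extension_def)
    qed
  qed
  thus "h \<in> range gasket_extension" by blast
next
  fix a show "gasket_extension a \<in> canonical_harmonic"
    by (rule canonical_harmonicI[OF gasket_extension_in_gasket_funs gasket_extension_proj])
qed

text \<open>The indicators of the corners form a basis of the corner values, and \<open>h\<^sub>c\<close> is three times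
  the extension of the indicator of \<open>c\<close>.\<close>

lemma (in gasket_chain) P_harmonic_gasket_eq: "P_harmonic_gasket p = range gasket_extension"
proof safe
  fix u assume "u \<in> P_harmonic_gasket p"
  then obtain c where u: "u \<in> gasket_funs" "\<And>x. u (proj x) = (\<Sum>i\<in>UNIV. c i * basic_harmonic_bdry p i x)"
    by (auto simp: P_harmonic_gasket_def)
  have "u (proj x) = bdry_val (\<lambda>i. 3 * c i) x" for x
    unfolding u(2) basic_harmonic_bdry_eq bdry_val_basis[of "\<lambda>i. 3 * c i" x] by (simp add: mult.left_commute mult.assoc)
  from canonical_harmonicI[OF u(1) this] show "u \<in> range gasket_extension"
    by (simp add: canonical_harmonic_eq)
next
  fix a
  have "gasket_extension a (proj x) = (\<Sum>i\<in>UNIV. (a i / 3) * basic_harmonic_bdry p i x)" for x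
    unfolding gasket_extension_proj basic_harmonic_bdry_eq bdry_val_basis[of a x] by simp
  thus "gasket_extension a \<in> P_harmonic_gasket p"
    unfolding P_harmonic_gasket_def using gasket_extension_in_gasket_funs[of a]
    by (intro CollectI conjI exI[of _ "\<lambda>i. a i / 3"]) auto
qed

lemma gasket_extension_linear:
  "gasket_extension (\<lambda>k. s * a k + t * b k) z = s * gasket_extension a z + t * gasket_extension b z"
proof -
  have "bdry_val (\<lambda>k. s * a k + t * b k) x = s * bdry_val a x + t * bdry_val b x" for x
    unfolding bdry_val_basis[of "\<lambda>k. s * a k + t * b k" x] bdry_val_basis[of a x] bdry_val_basis[of b x]
    by (simp add: sum_letter algebra_simps)
  thus ?thesis by (simp add: gasket_extension_def)
qed

lemma gasket_extension_basis:
  "gasket_extension a z = (\<Sum>c\<in>UNIV. a c * gasket_extension (\<lambda>k. of_bool (k = c)) z)"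
  by (simp add: gasket_extension_def bdry_val_basis[of a])

lemma fun_vs_sum_apply: "(\<Sum>v\<in>A. F v) z = (\<Sum>v\<in>A. F v z)" for F :: "'b \<Rightarrow> real ^ 2 \<Rightarrow> real"
  by (induction A rule: infinite_finite_induct) auto

lemma subspace_range_gasket_extension: "fun_vs.subspace (range gasket_extension)"
proof (rule fun_vs.subspaceI)
  have "gasket_extension (\<lambda>_. 0) = 0"
    using gasket_extension_linear[of 0 "\<lambda>_. 0" 0 "\<lambda>_. 0"] by (auto simp: fun_eq_iff)
  thus "0 \<in> range gasket_extension" by (metis rangeI)
next
  fix u v assume "u \<in> range gasket_extension" "v \<in> range gasket_extension"
  then obtain a b where "u = gasket_extension a" "v = gasket_extension b" by blast
  hence "u + v = gasket_extension (\<lambda>k. a k + b k)"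
    using gasket_extension_linear[of 1 a 1 b] by (auto simp: fun_eq_iff)
  thus "u + v \<in> range gasket_extension" by blast
next
  fix c :: real and u assume "u \<in> range gasket_extension"
  then obtain a where "u = gasket_extension a" by blast
  hence "(\<lambda>z. c * u z) = gasket_extension (\<lambda>k. c * a k)"
    using gasket_extension_linear[of c a 0 a] by (auto simp: fun_eq_iff)
  thus "(\<lambda>z. c * u z) \<in> range gasket_extension" by blast
qed

text \<open>The extensions of the three indicators are a basis; their values at the corners
  show that they are independent.\<close>

lemma dim_range_gasket_extension: "fun_vs.dim (range gasket_extension) = 3"
proof -
  define e where "e c = gasket_extension (\<lambda>k. of_bool (k = c))" for c
  have e_corner: "e c (corner d) = of_bool (d = c)" for c d by (simp add: e_def)
  have inj: "inj e" by (rule injI) (metis e_corner of_bool_eq_iff)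
  have "fun_vs.independent (range e)"
  proof (rule fun_vs.independent_if_scalars_zero)
    fix t v assume sum: "(\<Sum>v\<in>range e. (\<lambda>z. t v * v z)) = 0" and "v \<in> range e"
    then obtain c where v: "v = e c" by blast
    have "0 = (\<Sum>v\<in>range e. (\<lambda>z. t v * v z)) (corner c)" unfolding sum by simp
    also have "\<dots> = (\<Sum>d\<in>UNIV. t (e d) * e d (corner c))"
      unfolding fun_vs_sum_apply by (simp add: sum.reindex[OF inj])
    also have "\<dots> = t v" unfolding e_corner v by (cases c) (simp_all add: sum_letter)
    finally show "t v = 0" by simp
  qed simp
  moreover have "fun_vs.span (range e) = fun_vs.span (range gasket_extension)"
  proof
    show "fun_vs.span (range e) \<subseteq> fun_vs.span (range gasket_extension)"
      by (rule fun_vs.span_mono) (auto simp: e_def)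
    have "gasket_extension a \<in> fun_vs.span (range e)" for a
    proof -
      have "gasket_extension a = (\<Sum>c\<in>UNIV. (\<lambda>z. a c * e c z))"
        by (rule ext) (simp add: fun_vs_sum_apply e_def gasket_extension_basis[of a])
      also have "\<dots> \<in> fun_vs.span (range e)"
        by (intro fun_vs.span_sum fun_vs.span_scale fun_vs.span_base) auto
      finally show ?thesis .
    qed
    thus "fun_vs.span (range gasket_extension) \<subseteq> fun_vs.span (range e)"
      by (intro fun_vs.span_minimal) auto
  qed
  ultimately have "fun_vs.dim (range gasket_extension) = card (range e)"
    by (intro fun_vs.dim_eq_card)
  also have "\<dots> = 3" using card_image[OF inj] by (simp add: UNIV_letter)
  finally show ?thesis .
qed

theorem theorem3p6:
  fixes p :: real
  assumes "0 < p" and "p < 1 / 2"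
  shows "P_harmonic_gasket p = canonical_harmonic \<and>
    fun_vs.subspace (P_harmonic_gasket p) \<and> fun_vs.dim (P_harmonic_gasket p) = 3"
proof -
  interpret gasket_chain p using assms by unfold_locales
  show ?thesis
    unfolding P_harmonic_gasket_eq canonical_harmonic_eq
    using subspace_range_gasket_extension dim_range_gasket_extension by simp
qed

end
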